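(* Let $\sigma$ be an admissible weight on $\mathbb{D}$, let $\alpha>-1$, let $\Omega$ be a finite positive Borel measure on $\mathbb{D}$, let $0<p\le q<\infty$, and let $t>\frac{2q}{p(\alpha+2)}$. Then the following statements are equivalent: (a) $\Omega$ is a vanishing $(p,q,\sigma)$-Bergman Carleson measure. (b) $\dfrac{\widetilde{\Omega}_{t}(z)}{\sigma(z)^{q/p}(1-|z|^{2})^{\frac{2q}{p}-\frac{(\alpha+2)t}{2}}}\to 0$ as $z\to\partial\mathbb{D}$. (c) For some (equivalently, for any) $R\in(0,1)$, $\dfrac{\widehat{\Omega}_{R}(z)}{\sigma(z)^{q/p}(1-|z|^{2})^{\frac{2(q-p)}{p}}}\to 0$ as $z\to\partial\mathbb{D}$. (d) For some (equivalently, for any) $r$-lattice $\{z_k\}_{k=1}^{\infty}$ with $r\in(0,1)$, $\dfrac{\widehat{\Omega}_{r}(z_{k})}{\sigma(z_k)^{q/p}(1-|z_k|^{2})^{\frac{2(q-p)}{p}}}\to 0$ as $k\to\infty$.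
   Context: $\mathbb{D}=\{z\in\mathbb{C}:|z|<1\}$, $\mathcal{H}(\mathbb{D})$ is the space of analytic functions on $\mathbb{D}$, and $dA=\frac{dx\,dy}{\pi}$ is normalized area measure; $z\to\partial\mathbb{D}$ means $|z|\to1$. A weight is a positive integrable function $\sigma\in C^2[0,1]$, extended to $\mathbb{D}$ by $\sigma(z)=\sigma(|z|)$. It is admissible if $\sigma$ is non-increasing on $[0,1)$ and $\sigma(r)(1-r)^{-(1+\delta)}$ is non-decreasing on $[0,1)$ for some $\delta>0$. For $0<p<\infty$, $A^p_\sigma=\{f\in\mathcal{H}(\mathbb{D}):\|f\|^p_{A^p_\sigma}=\int_{\mathbb{D}}|f|^p\sigma\,dA<\infty\}$. A finite positive Borel measure $\Omega$ on $\mathbb{D}$ is a vanishing $(p,q,\sigma)$-Bergman Carleson measure if $\int_{\mathbb{D}}|f_n|^q\,d\Omega\to0$ as $n\to\infty$ whenever $\{f_n\}$ is a bounded sequence in $A^p_\sigma$ which converges to $0$ uniformly on every compact subset of $\mathbb{D}$. For $a\in\mathbb{D}$ and $r\in(0,1)$, $E(a,r)=\{z\in\mathbb{D}:|\frac{a-z}{1-\bar a z}|<r\}$ is the pseudohyperbolic disk and $|E(a,r)|$ is its area. A sequence $\{z_k\}_{k=1}^\infty\subset\mathbb{D}$ is an $r$-lattice if the disks $E(z_k,r)$ cover $\mathbb{D}$ and there is an integer $M>0$ such that each $z\in\mathbb{D}$ belongs to at most $M$ of the disks $E(z_k,\frac{1+r}{2})$. For $\alpha>-1$, $K^\alpha(z,w)=(1-\bar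 w z)^{-(\alpha+2)}$ and $k^\alpha_z(w)=K^\alpha(z,w)/\sqrt{K^\alpha(z,z)}$. The $t$-Berezin transform of $\Omega$ is $\widetilde{\Omega}_t(z)=\int_{\mathbb{D}}|k^\alpha_z(w)|^t\,d\Omega(w)$, and the averaging function is $\widehat{\Omega}_r(z)=\Omega(E(z,r))/|E(z,r)|$. *)

theory Defs
  imports "HOL-Complex_Analysis.Complex_Analysis"
begin

abbreviation unit_disk :: "complex set" where
  "unit_disk \<equiv> ball 0 1"

text \<open>The normalized area measure \<open>dA = dx dy / \<pi>\<close> on the unit disk.\<close>

definition area_measure :: "complex measure" where
  "area_measure = scale_measure (ennreal (1 / pi)) (restrict_space lborel unit_disk)"

definition C2_on_unit_interval :: "(real \<Rightarrow> real) \<Rightarrow> bool" where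
  "C2_on_unit_interval \<sigma> \<longleftrightarrow> (\<exists>\<sigma>' \<sigma>''.
     (\<forall>x\<in>{0..1}. (\<sigma> has_real_derivative \<sigma>' x) (at x within {0..1})) \<and>
     (\<forall>x\<in>{0..1}. (\<sigma>' has_real_derivative \<sigma>'' x) (at x within {0..1})) \<and>
     continuous_on {0..1} \<sigma>'')"

text \<open>
  A weight is a function on the closed interval \<open>[0,1]\<close>, so positivity includes the end point 1.
  Positivity on \<open>[0,1)\<close> alone would admit \<open>\<sigma> r = (1 - r)^10\<close>, for which
  the Berezin condition of the theorem fails when \<open>\<Omega>\<close> is a point mass at 0 and \<open>t\<close> is
  close to its lower bound, although that measure is vanishing Carleson.
  The radial extension of a weight to the disk is written \<open>\<sigma> (cmod z)\<close>.
\<close>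

definition weight :: "(real \<Rightarrow> real) \<Rightarrow> bool" where
  "weight \<sigma> \<longleftrightarrow>
     C2_on_unit_interval \<sigma> \<and> (\<forall>x\<in>{0..1}. 0 < \<sigma> x) \<and> set_integrable lborel {0..1} \<sigma>"

definition admissible_weight :: "(real \<Rightarrow> real) \<Rightarrow> bool" where
  "admissible_weight \<sigma> \<longleftrightarrow> weight \<sigma> \<and> antimono_on {0..<1} \<sigma> \<and>
     (\<exists>\<delta>>0. mono_on {0..<1} (\<lambda>x. \<sigma> x * (1 - x) powr (- (1 + \<delta>))))"

definition bergman_integral :: "real \<Rightarrow> (real \<Rightarrow> real) \<Rightarrow> (complex \<Rightarrow> complex) \<Rightarrow> ennreal" where
  "bergman_integral p \<sigma> f =
     (\<integral>\<^sup>+ z. ennreal (cmod (f z) powr p * \<sigma> (cmod z)) \<partial>area_measure)"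

definition bergman_space :: "real \<Rightarrow> (real \<Rightarrow> real) \<Rightarrow> (complex \<Rightarrow> complex) set" where
  "bergman_space p \<sigma> = {f. f holomorphic_on unit_disk \<and> bergman_integral p \<sigma> f < \<infinity>}"

definition bergman_norm :: "real \<Rightarrow> (real \<Rightarrow> real) \<Rightarrow> (complex \<Rightarrow> complex) \<Rightarrow> real" where
  "bergman_norm p \<sigma> f = enn2real (bergman_integral p \<sigma> f) powr (1 / p)"

definition finite_borel_measure_on_disk :: "complex measure \<Rightarrow> bool" where
  "finite_borel_measure_on_disk \<Omega> \<longleftrightarrow>
     sets \<Omega> = sets (restrict_space borel unit_disk) \<and> finite_measure \<Omega>"

text \<open>
  The integrals of \<open>|f\<^sub>n|\<^sup>q\<close> are taken in \<open>ennreal\<close>, so that a divergent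
  integral counts as infinite.
\<close>

definition vanishing_bergman_carleson ::
  "real \<Rightarrow> real \<Rightarrow> (real \<Rightarrow> real) \<Rightarrow> complex measure \<Rightarrow> bool" where
  "vanishing_bergman_carleson p q \<sigma> \<Omega> \<longleftrightarrow>
     (\<forall>f :: nat \<Rightarrow> complex \<Rightarrow> complex.
        (\<forall>n. f n \<in> bergman_space p \<sigma>) \<longrightarrow>
        (\<exists>C. \<forall>n. bergman_norm p \<sigma> (f n) \<le> C) \<longrightarrow>
        (\<forall>K. compact K \<and> K \<subseteq> unit_disk \<longrightarrow> uniform_limit K f (\<lambda>_. 0) sequentially) \<longrightarrow>
        (\<lambda>n. \<integral>\<^sup>+ w. ennreal (cmod (f n w) powr q) \<partial>\<Omega>) \<longlonglongrightarrow> 0)"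

definition pseudohyperbolic_disk :: "complex \<Rightarrow> real \<Rightarrow> complex set" where
  "pseudohyperbolic_disk a r = {z \<in> unit_disk. cmod ((a - z) / (1 - cnj a * z)) < r}"

text \<open>Sequences are indexed from 0 instead of 1.\<close>

definition lattice_in_disk :: "real \<Rightarrow> (nat \<Rightarrow> complex) \<Rightarrow> bool" where
  "lattice_in_disk r z \<longleftrightarrow>
     range z \<subseteq> unit_disk \<and>
     unit_disk \<subseteq> (\<Union>k. pseudohyperbolic_disk (z k) r) \<and>
     (\<exists>M::nat. 0 < M \<and> (\<forall>w\<in>unit_disk.
        finite {k. w \<in> pseudohyperbolic_disk (z k) ((1 + r) / 2)} \<and>
        card {k. w \<in> pseudohyperbolic_disk (z k) ((1 + r) / 2)} \<le> M))"

text \<open>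
  For \<open>z\<close>, \<open>w\<close> in the disk, \<open>1 - cnj w * z\<close> has positive real part, so
  the principal branch of the power is the analytic one; \<open>bergman_kernel \<alpha> z z\<close> is
  a positive real, so \<open>csqrt\<close> is the usual root.
\<close>

definition bergman_kernel :: "real \<Rightarrow> complex \<Rightarrow> complex \<Rightarrow> complex" where
  "bergman_kernel \<alpha> z w = (1 - cnj w * z) powr (- complex_of_real (\<alpha> + 2))"

definition normalized_kernel :: "real \<Rightarrow> complex \<Rightarrow> complex \<Rightarrow> complex" where
  "normalized_kernel \<alpha> z w = bergman_kernel \<alpha> z w / csqrt (bergman_kernel \<alpha> z z)"

definition berezin_transform :: "real \<Rightarrow> real \<Rightarrow> complex measure \<Rightarrow> complex \<Rightarrow> real" where
  "berezin_transform \<alpha> t \<Omega> z = (\<integral>w. cmod (normalized_kernel \<alpha> z w) powr t \<partial>\<Omega>)"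

definition averaging_function :: "real \<Rightarrow> complex measure \<Rightarrow> complex \<Rightarrow> real" where
  "averaging_function r \<Omega> z =
     measure \<Omega> (pseudohyperbolic_disk z r) / measure area_measure (pseudohyperbolic_disk z r)"

text \<open>The filter of \<open>z \<rightarrow> \<partial>D\<close> from inside: \<open>|z| \<rightarrow> 1\<close> with \<open>|z| < 1\<close>.\<close>

definition to_boundary :: "complex filter" where
  "to_boundary = filtercomap cmod (at_left 1)"

end

theory Submission
  imports Defs
begin

text \<open>
A weight is continuous and positive on the closed interval \<open>[0,1]\<close>, so it lies between
two positive constants there, and \<open>\<sigma>\<close> affects all quantities only up to bounded factors.
Write \<open>d(z) = 1 - |z|\<^sup>2\<close>, \<open>\<gamma> = 2q/p\<close> and \<open>s = (\<alpha>+2)t\<close>, so that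
\<open>s > \<gamma> \<ge> 2\<close>. Since \<open>E(z,R)\<close> has area comparable to \<open>d(z)\<^sup>2\<close>, the conditions become:
(b) \<open>d(z)\<close> to the power \<open>s - \<gamma>\<close> times \<open>\<integral> |1 - cnj z * w| powr (-s) d\<Omega>(w)\<close>
tends to 0 at the boundary; (c) \<open>\<Omega>(E(z,R)) / d(z) powr \<gamma>\<close> tends to 0 at the boundary;
(d) the same quotient tends to 0 along a lattice.

(a) implies (b): the functions \<open>w \<mapsto> (1 - cnj z * w) powr (-s/q)\<close>, scaled by
\<open>d(z) powr ((s - \<gamma>)/q)\<close>, are bounded in the Bergman space by the Forelli-Rudin estimate
\<open>kernel_power_integral_bound\<close>, and they tend to 0 locally uniformly because \<open>s > \<gamma>\<close>; the integral
of their \<open>q\<close>-th power is the quantity in (b).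

(b) implies (c) for every \<open>R\<close>: on \<open>E(z,R)\<close> the kernel \<open>|1 - cnj z * w|\<close> is at most a
constant times \<open>d(z)\<close>.

(c) for one \<open>R\<close> implies (a): by the sub-mean value property of \<open>|f| powr q\<close> on Euclidean
disks inside \<open>E(w,R)\<close> and Fubini, \<open>\<integral> |f| powr q d\<Omega>\<close> is at most a constant times
\<open>\<integral> |f| powr q * \<Omega>(E(z,R)) / d(z)\<^sup>2 dA(z)\<close>. Near the boundary the disk mass contributes
\<open>\<epsilon> d(z) powr \<gamma>\<close>, and the growth bound \<open>d\<^sup>2 |f| powr p \<le> C\<close> absorbs the excess
\<open>|f| powr (q - p)\<close>; away from the boundary the convergence is uniform.

(c) implies (d) because a lattice leaves every compact subset of the disk. Conversely
a pseudohyperbolic disk of small radius around any point meets at most \<open>M\<close> of the lattice disks,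
all with centres of comparable \<open>d\<close>, so (d) for one lattice gives (c) for one radius. Lattices
exist: a maximal set of points with pairwise pseudohyperbolic distance at least \<open>r\<close> is one.

The sub-mean value property for \<open>p < 1\<close> is derived from the case \<open>p = 1\<close> by looking at a point
where \<open>|f|\<close> times a power of the distance to the boundary is maximal. The case \<open>p = 1\<close>
averages the Cauchy formula over all circles at once, using that Lebesgue measure is invariant
under rotations.
\<close>

section \<open>Area integrals in the complex plane\<close>

lemma lborel_complex_eq_distr:
  "lborel = distr (lborel :: (real \<times> real) measure) borel (\<lambda>(x, y). Complex x y)"
proof (rule lborel_eqI)
  fix l u :: complex
  assume le: "\<And>b. b \<in> Basis \<Longrightarrow> l \<bullet> b \<le> u \<bullet> b"
  have m: "(\<lambda>(x, y). Complex x y) \<in> borel_measurable (lborel :: (real \<times> real) measure)"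
    by (auto simp: split_beta Complex_eq intro!: borel_measurable_continuous_onI continuous_intros)
  have "(\<lambda>(x, y). Complex x y) -` box l u = box (Re l, Im l) (Re u, Im u)"
    by (auto simp: box_def Basis_complex_def Basis_prod_def)
  then show "emeasure (distr (lborel :: (real \<times> real) measure) borel (\<lambda>(x, y). Complex x y)) (box l u)
      = ennreal (\<Prod>b\<in>Basis. (u - l) \<bullet> b)"
    using le[of 1] le[of \<i>] m
    by (simp add: emeasure_distr emeasure_lborel_box_eq Basis_complex_def Basis_prod_def)
qed simp

text \<open>
Cartesian Fubini, in both orders of integration; this makes shears accessible.
\<close>

lemma nn_integral_lborel_complex:
  assumes [measurable]: "g \<in> borel_measurable (borel :: complex measure)"
  shows "(\<integral>\<^sup>+ z. g z \<partial>lborel) = (\<integral>\<^sup>+ y. \<integral>\<^sup>+ x. g (Complex x y) \<partial>lborel \<partial>lborel)"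
    and "(\<integral>\<^sup>+ z. g z \<partial>lborel) = (\<integral>\<^sup>+ x. \<integral>\<^sup>+ y. g (Complex x y) \<partial>lborel \<partial>lborel)"
proof -
  have [measurable]: "(\<lambda>(x, y). Complex x y) \<in> borel_measurable (borel \<Otimes>\<^sub>M borel)"
    unfolding borel_prod
    by (auto simp: split_beta Complex_eq intro!: borel_measurable_continuous_onI continuous_intros)
  have "(\<integral>\<^sup>+ z. g z \<partial>lborel) = (\<integral>\<^sup>+ (x, y). g (Complex x y) \<partial>(lborel \<Otimes>\<^sub>M lborel))"
    by (subst lborel_complex_eq_distr, subst nn_integral_distr)
       (auto simp: lborel_prod split_beta' borel_prod Complex_eq
         intro!: borel_measurable_continuous_onI continuous_intros)
  also have "\<dots> = (\<integral>\<^sup>+ x. \<integral>\<^sup>+ y. g (Complex x y) \<partial>lborel \<partial>lborel)"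
    by (simp add: lborel.nn_integral_fst[symmetric] split_beta')
  finally show "(\<integral>\<^sup>+ z. g z \<partial>lborel) = (\<integral>\<^sup>+ x. \<integral>\<^sup>+ y. g (Complex x y) \<partial>lborel \<partial>lborel)" .
  also have "\<dots> = (\<integral>\<^sup>+ y. \<integral>\<^sup>+ x. g (Complex x y) \<partial>lborel \<partial>lborel)"
    by (rule lborel_pair.Fubini') measurable
  finally show "(\<integral>\<^sup>+ z. g z \<partial>lborel) = (\<integral>\<^sup>+ y. \<integral>\<^sup>+ x. g (Complex x y) \<partial>lborel \<partial>lborel)" .
qed

lemma nn_integral_lborel_shift:
  fixes c :: "'a :: euclidean_space"
  assumes [measurable]: "g \<in> borel_measurable borel"
  shows "(\<integral>\<^sup>+ x. g (c + x) \<partial>lborel) = (\<integral>\<^sup>+ x. g x \<partial>lborel)"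
  by (subst (2) lborel_affine[of 1 c]) (simp_all add: nn_integral_density nn_integral_distr)

lemma nn_integral_lborel_scale:
  fixes g :: "'a :: euclidean_space \<Rightarrow> ennreal"
  assumes [measurable]: "g \<in> borel_measurable borel" and "c \<noteq> 0"
  shows "(\<integral>\<^sup>+ x. g x \<partial>lborel) = ennreal (\<bar>c\<bar> ^ DIM('a)) * (\<integral>\<^sup>+ x. g (c *\<^sub>R x) \<partial>lborel)"
  by (subst lborel_affine[of c 0])
     (use assms in \<open>simp_all add: nn_integral_density nn_integral_distr nn_integral_cmult\<close>)

text \<open>
On each horizontal or vertical line a shear is a translation.
\<close>

lemma nn_integral_lborel_shear:
  assumes [measurable]: "g \<in> borel_measurable (borel :: complex measure)"
  shows "(\<integral>\<^sup>+ z. g (Complex (Re z + s * Im z) (Im z)) \<partial>lborel) = (\<integral>\<^sup>+ z. g z \<partial>lborel)"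
    and "(\<integral>\<^sup>+ z. g (Complex (Re z) (Im z + s * Re z)) \<partial>lborel) = (\<integral>\<^sup>+ z. g z \<partial>lborel)"
proof -
  have [measurable]: "(\<lambda>x. Complex x y) \<in> borel_measurable borel" for y
    by (auto simp: Complex_eq intro!: borel_measurable_continuous_onI continuous_intros)
  have [measurable]: "(\<lambda>y. Complex x y) \<in> borel_measurable borel" for x
    by (auto simp: Complex_eq intro!: borel_measurable_continuous_onI continuous_intros)
  have [measurable]: "(\<lambda>z. Complex (Re z + s * Im z) (Im z)) \<in> borel_measurable borel"
    by (auto simp: Complex_eq intro!: borel_measurable_continuous_onI continuous_intros)
  have [measurable]: "(\<lambda>z. Complex (Re z) (Im z + s * Re z)) \<in> borel_measurable borel"
    by (auto simp: Complex_eq intro!: borel_measurable_continuous_onI continuous_intros)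
  have "(\<integral>\<^sup>+ x. g (Complex (x + s * y) y) \<partial>lborel) = (\<integral>\<^sup>+ x. g (Complex x y) \<partial>lborel)" for y
    using nn_integral_lborel_shift[of "\<lambda>x. g (Complex x y)" "s * y"] by (simp add: add.commute)
  then show "(\<integral>\<^sup>+ z. g (Complex (Re z + s * Im z) (Im z)) \<partial>lborel) = (\<integral>\<^sup>+ z. g z \<partial>lborel)"
    by (simp add: nn_integral_lborel_complex(1))
  have "(\<integral>\<^sup>+ y. g (Complex x (y + s * x)) \<partial>lborel) = (\<integral>\<^sup>+ y. g (Complex x y) \<partial>lborel)" for x
    using nn_integral_lborel_shift[of "\<lambda>y. g (Complex x y)" "s * x"] by (simp add: add.commute)
  then show "(\<integral>\<^sup>+ z. g (Complex (Re z) (Im z + s * Re z)) \<partial>lborel) = (\<integral>\<^sup>+ z. g z \<partial>lborel)"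
    by (simp add: nn_integral_lborel_complex(2))
qed

text \<open>
A rotation by an angle other than 0 and \<open>\<pi>\<close> is a product of three shears
(horizontal, vertical, horizontal).
\<close>

lemma nn_integral_lborel_rotate:
  assumes g [measurable]: "g \<in> borel_measurable (borel :: complex measure)" and u: "cmod u = 1"
  shows "(\<integral>\<^sup>+ z. g (z * u) \<partial>lborel) = (\<integral>\<^sup>+ z. g z \<partial>lborel)"
proof (cases "Im u = 0")
  case True
  then have "u = 1 \<or> u = -1"
    using u by (auto simp: complex_eq_iff cmod_def abs_square_eq_1)
  then show ?thesis
    using nn_integral_lborel_scale[of g "-1"] by auto
next
  case False
  (* The horizontal shear parameter forced by matching matrix entries with those of
     the rotation by u when the vertical shear has parameter Im u. *)
  define s where "s = (Re u - 1) / Im u"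
  let ?X = "\<lambda>z. Complex (Re z + s * Im z) (Im z)"
  let ?Y = "\<lambda>z. Complex (Re z) (Im z + Im u * Re z)"
  have [measurable]: "?X \<in> borel_measurable borel" "?Y \<in> borel_measurable borel"
    by (auto simp: Complex_eq intro!: borel_measurable_continuous_onI continuous_intros)
  have n: "(Re u)\<^sup>2 + (Im u)\<^sup>2 = 1"
    using u by (simp add: cmod_def)
  have 1: "s * Im u = Re u - 1"
    using False by (simp add: s_def)
  have 2: "s * (1 + Re u) = - Im u"
    using False n by (simp add: s_def field_simps power2_eq_square)
  have "?X (?Y (?X z)) = z * u" for z
  proof (rule complex_eqI)
    have "Re (?X (?Y (?X z))) = Re z * (1 + s * Im u) + Im z * (s * (1 + (1 + s * Im u)))"
      by (simp add: algebra_simps)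
    also have "\<dots> = Re z * Re u + Im z * (s * (1 + Re u))"
      unfolding 1 by simp
    finally show "Re (?X (?Y (?X z))) = Re (z * u)"
      unfolding 2 by simp
    have "Im (?X (?Y (?X z))) = Im z * (1 + s * Im u) + Re z * Im u"
      by (simp add: algebra_simps)
    then show "Im (?X (?Y (?X z))) = Im (z * u)"
      unfolding 1 by simp
  qed
  then have "(\<integral>\<^sup>+ z. g (z * u) \<partial>lborel) = (\<integral>\<^sup>+ z. g (?X (?Y (?X z))) \<partial>lborel)"
    by simp
  also have "\<dots> = (\<integral>\<^sup>+ z. g (?X (?Y z)) \<partial>lborel)"
    by (rule nn_integral_lborel_shear(1)[of "\<lambda>z. g (?X (?Y z))"]) measurable
  also have "\<dots> = (\<integral>\<^sup>+ z. g (?X z) \<partial>lborel)"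
    by (rule nn_integral_lborel_shear(2)[of "\<lambda>z. g (?X z)"]) measurable
  also have "\<dots> = (\<integral>\<^sup>+ z. g z \<partial>lborel)"
    by (rule nn_integral_lborel_shear(1)) measurable
  finally show ?thesis .
qed

text \<open>
The Cauchy formula on the unit circle for \<open>w \<mapsto> f (z * w)\<close>. Parametrizing by the point \<open>z\<close>
instead of a radius lets the inequality be integrated over \<open>z\<close> without polar coordinates.
\<close>

lemma circle_mean_value_inequality:
  assumes hol: "f holomorphic_on ball 0 r" and z: "z \<in> ball 0 r"
  shows "ennreal (2 * pi * cmod (f 0)) \<le>
    (\<integral>\<^sup>+ t. ennreal (cmod (f (z * cis t))) * indicator {0..2*pi} t \<partial>lborel)"
proof -
  have sub: "(*) z ` cball 0 1 \<subseteq> ball 0 r"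
  proof
    fix y assume "y \<in> (*) z ` cball 0 1"
    then obtain x where "y = z * x" "cmod x \<le> 1" by (auto simp only: image_iff mem_cball_0)
    then show "y \<in> ball 0 r"
      using z mult_left_le[of "cmod x" "cmod z"] by (auto simp: norm_mult)
  qed
  have hz: "(\<lambda>w. f (z * w)) holomorphic_on cball 0 1"
    using holomorphic_on_compose_gen[OF _ hol sub] by (auto simp: o_def intro!: holomorphic_intros)
  have "((\<lambda>u. f (z * u) / (u - 0)) has_contour_integral 2 * of_real pi * \<i> * f (z * 0)) (circlepath 0 1)"
    by (rule Cauchy_integral_circlepath_simple[OF hz]) simp
  then have 1: "((\<lambda>t. f (z * cis t) * \<i>) has_integral 2 * of_real pi * \<i> * f 0) {0..2*pi}"
    unfolding circlepath_def by (subst (asm) has_contour_integral_part_circlepath_iff) auto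
  have cont: "continuous_on {0..2*pi} (\<lambda>t. f (z * cis t))"
  proof -
    have "continuous_on (cball 0 1) (\<lambda>w. f (z * w))"
      using hz holomorphic_on_imp_continuous_on by blast
    then have "continuous_on {0..2*pi} ((\<lambda>w. f (z * w)) \<circ> cis)"
      by (intro continuous_on_compose continuous_intros) (auto elim: continuous_on_subset)
    then show ?thesis by (simp add: o_def)
  qed
  then have cont': "continuous_on {0..2*pi} (\<lambda>t. cmod (f (z * cis t)))"
    by (intro continuous_intros)
  have "cmod (integral {0..2*pi} (\<lambda>t. f (z * cis t) * \<i>)) \<le> integral {0..2*pi} (\<lambda>t. cmod (f (z * cis t)))"
    by (rule integral_norm_bound_integral)
       (auto simp: norm_mult intro!: integrable_continuous_interval cont' continuous_intros cont)
  then have 2: "2 * pi * cmod (f 0) \<le> integral {0..2*pi} (\<lambda>t. cmod (f (z * cis t)))"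
    using integral_unique[OF 1] by (simp add: norm_mult)
  have si: "set_integrable lborel {0..2*pi} (\<lambda>t. cmod (f (z * cis t)))"
    using borel_integrable_compact[OF _ cont'] by (simp add: set_integrable_def indicator_def if_distrib cong: if_cong)
  have "integral {0..2*pi} (\<lambda>t. cmod (f (z * cis t))) = (LINT t:{0..2*pi}|lborel. cmod (f (z * cis t)))"
    using set_borel_integral_eq_integral(2)[OF si] by simp
  also have "ennreal \<dots> = (\<integral>\<^sup>+ t. ennreal (indicator {0..2*pi} t *\<^sub>R cmod (f (z * cis t))) \<partial>lborel)"
    unfolding set_lebesgue_integral_def
    by (rule nn_integral_eq_integral[symmetric]) (use si in \<open>auto simp: set_integrable_def\<close>)
  also have "\<dots> = (\<integral>\<^sup>+ t. ennreal (cmod (f (z * cis t))) * indicator {0..2*pi} t \<partial>lborel)"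
    by (intro nn_integral_cong) (auto simp: indicator_def)
  finally show ?thesis
    using 2 by (metis ennreal_leI)
qed

text \<open>
Integrate the circle inequality over the disk, swap the integrals, and use rotation invariance:
the inner integral is the same for every angle.
\<close>

lemma area_mean_value_inequality:
  assumes hol: "f holomorphic_on ball a r" and "0 < r"
  shows "ennreal (pi * r\<^sup>2 * cmod (f a)) \<le> (\<integral>\<^sup>+ z. ennreal (cmod (f z)) * indicator (ball a r) z \<partial>lborel)"
proof -
  define F where "F = (\<lambda>z. f (a + z))"
  define G where "G = (\<lambda>z. ennreal (cmod (F z)) * indicator (ball 0 r) z)"
  have "(+) a ` ball 0 r \<subseteq> ball a r"
    by (auto simp: dist_norm)
  then have hF: "F holomorphic_on ball 0 r"
    unfolding F_def using holomorphic_on_compose_gen[OF _ hol, of "\<lambda>z. a + z" "ball 0 r"]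
    by (simp add: o_def holomorphic_on_add holomorphic_on_id)
  have "(\<lambda>z. indicator (ball 0 r) z *\<^sub>R cmod (F z)) \<in> borel_measurable borel"
    by (intro borel_measurable_continuous_on_indicator continuous_intros holomorphic_on_imp_continuous_on hF) auto
  then have "(\<lambda>z. ennreal (indicator (ball 0 r) z *\<^sub>R cmod (F z))) \<in> borel_measurable borel"
    by measurable
  also have "(\<lambda>z. ennreal (indicator (ball 0 r) z *\<^sub>R cmod (F z))) = G"
    by (auto simp: G_def indicator_def)
  finally have G [measurable]: "G \<in> borel_measurable borel" .
  have [measurable]: "cis \<in> borel_measurable borel"
    by (intro borel_measurable_continuous_onI continuous_intros)
  have "ennreal (2 * pi) * ennreal (pi * r\<^sup>2 * cmod (f a))
      = (\<integral>\<^sup>+ z. ennreal (2 * pi * cmod (F 0)) * indicator (ball 0 r) z \<partial>(lborel :: complex measure))"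
    using \<open>0 < r\<close> by (subst nn_integral_cmult_indicator)
       (simp_all add: emeasure_ball unit_ball_vol_2 F_def mult_ac flip: ennreal_mult)
  also have "\<dots> \<le> (\<integral>\<^sup>+ z. (\<integral>\<^sup>+ t. G (z * cis t) * indicator {0..2*pi} t \<partial>lborel) \<partial>lborel)"
  proof (rule nn_integral_mono)
    fix z :: complex
    have "ennreal (2 * pi * cmod (F 0)) \<le> (\<integral>\<^sup>+ t. G (z * cis t) * indicator {0..2*pi} t \<partial>lborel)"
      if "z \<in> ball 0 r"
      using circle_mean_value_inequality[OF hF that] that by (simp add: G_def norm_mult)
    then show "ennreal (2 * pi * cmod (F 0)) * indicator (ball 0 r) z
        \<le> (\<integral>\<^sup>+ t. G (z * cis t) * indicator {0..2*pi} t \<partial>lborel)"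
      by (auto simp: indicator_def)
  qed
  also have "\<dots> = (\<integral>\<^sup>+ t. (\<integral>\<^sup>+ z. G (z * cis t) * indicator {0..2*pi} t \<partial>lborel) \<partial>lborel)"
    by (rule lborel_pair.Fubini') measurable
  also have "\<dots> = (\<integral>\<^sup>+ t. (\<integral>\<^sup>+ z. G z \<partial>lborel) * indicator {0..2*pi} t \<partial>lborel)"
    by (intro nn_integral_cong) (simp add: nn_integral_multc nn_integral_lborel_rotate)
  also have "\<dots> = ennreal (2 * pi) * (\<integral>\<^sup>+ z. G z \<partial>lborel)"
    by (simp add: nn_integral_cmult mult.commute)
  finally have "ennreal (pi * r\<^sup>2 * cmod (f a)) \<le> (\<integral>\<^sup>+ z. G z \<partial>lborel)"
    by (simp add: ennreal_mult_le_mult_iff)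
  also have "\<dots> = (\<integral>\<^sup>+ z. ennreal (cmod (f z)) * indicator (ball a r) z \<partial>lborel)"
  proof -
    have "(\<lambda>z. indicator (ball a r) z *\<^sub>R cmod (f z)) \<in> borel_measurable borel"
      by (intro borel_measurable_continuous_on_indicator continuous_intros holomorphic_on_imp_continuous_on hol) auto
    then have "(\<lambda>z. ennreal (indicator (ball a r) z *\<^sub>R cmod (f z))) \<in> borel_measurable borel"
      by measurable
    also have "(\<lambda>z. ennreal (indicator (ball a r) z *\<^sub>R cmod (f z)))
       = (\<lambda>z. ennreal (cmod (f z)) * indicator (ball a r) z)"
      by (auto simp: indicator_def)
    finally have "(\<integral>\<^sup>+ z. ennreal (cmod (f (a + z))) * indicator (ball a r) (a + z) \<partial>lborel) = 
       (\<integral>\<^sup>+ z. ennreal (cmod (f z)) * indicator (ball a r) z \<partial>lborel)"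
      by (rule nn_integral_lborel_shift)
    then show ?thesis
      by (simp add: G_def F_def indicator_def dist_norm)
  qed
  finally show ?thesis .
qed

section \<open>Powers of holomorphic functions have the sub-mean value property\<close>

text \<open>
Let \<open>z0\<close> maximize \<open>|f z| * (\<rho> - |z - a|) powr (2/p)\<close>, with maximum \<open>N\<close>, and let \<open>d\<close> be the
distance from \<open>z0\<close> to the circle of radius \<open>\<rho>\<close>. On the disk of radius \<open>d/2\<close> about \<open>z0\<close>,
maximality bounds \<open>|f|\<close> by a multiple of \<open>N * d powr (-2/p)\<close>; splitting
\<open>|f| = |f| powr p * |f| powr (1-p)\<close> in the mean value inequality at \<open>z0\<close> gives
\<open>N \<le> A * N powr (1-p) * I\<close>, where all powers of \<open>d\<close> cancel. Dividing by \<open>N powr (1-p)\<close> bounds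
\<open>N powr p\<close>, hence the value at the centre \<open>a\<close>.
\<close>

lemma power_mean_value_inequality_le_1:
  assumes p: "0 < p" "p \<le> 1" and hol: "f holomorphic_on ball a r" and "0 < r"
  shows "ennreal (r\<^sup>2 * cmod (f a) powr p) \<le>
    ennreal (4 * (4 / pi * 4 powr ((1 - p) / p))) *
    (\<integral>\<^sup>+ z. ennreal (cmod (f z) powr p) * indicator (ball a r) z \<partial>lborel)"
proof -
  define \<rho> where "\<rho> = r / 2"
  have \<rho>: "0 < \<rho>" "\<rho> < r" using \<open>0 < r\<close> by (auto simp: \<rho>_def)
  (* Continuity up to the circle of radius \<rho> = r / 2 makes the maximum exist; the
     exponent 2 / p is the one for which the powers of d cancel below. *)
  define h where "h = (\<lambda>z. cmod (f z) * (\<rho> - dist a z) powr (2 / p))"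
  have contf: "continuous_on (ball a r) f"
    using hol by (rule holomorphic_on_imp_continuous_on)
  have "continuous_on (cball a \<rho>) h"
    unfolding h_def using \<rho> p
    by (intro continuous_intros continuous_on_subset[OF contf] continuous_on_powr') auto
  moreover have "cball a \<rho> \<noteq> {}" using \<rho> by auto
  ultimately obtain z0 where z0: "z0 \<in> cball a \<rho>" and max: "\<And>z. z \<in> cball a \<rho> \<Longrightarrow> h z \<le> h z0"
    using continuous_attains_sup[OF compact_cball] by blast
  define N where "N = h z0"
  define I where "I = (\<integral>\<^sup>+ z. ennreal (cmod (f z) powr p) * indicator (ball a r) z \<partial>lborel)"
  define A where "A = 4 / pi * 4 powr ((1 - p) / p)"
  have fa: "cmod (f a) * \<rho> powr (2 / p) \<le> N"
    using max[of a] \<rho> by (simp add: h_def N_def)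
  have "0 \<le> N" unfolding N_def h_def by auto
  show ?thesis
  proof (cases "N = 0 \<or> I = \<infinity>")
    case True
    then show ?thesis
    proof
      assume "N = 0"
      then have "f a = 0" using fa \<rho>
        by (simp add: mult_le_0_iff)
      then show ?thesis by simp
    next
      assume "I = \<infinity>"
      moreover have "A > 0" by (simp add: A_def)
      ultimately show ?thesis by (simp add: I_def[symmetric] A_def[symmetric] ennreal_mult_top)
    qed
  next
    case False
    then have N: "0 < N" using \<open>0 \<le> N\<close> by simp
    obtain J where J: "I = ennreal J" "0 \<le> J" using False by (cases I) auto
    define d where "d = \<rho> - dist a z0"
    have d: "0 < d" using N z0 by (auto simp: N_def h_def d_def less_le)
    have sub: "ball z0 (d/2) \<subseteq> ball a r"
    proof
      fix z assume "z \<in> ball z0 (d/2)"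
      then show "z \<in> ball a r"
        using dist_triangle[of a z z0] d \<rho> by (auto simp: d_def)
    qed
    (* An upper bound for |f| powr (1 - p) on the disk of radius d / 2 about z0. *)
    define B where "B = (N * (d / 2) powr (-(2 / p))) powr (1 - p)"
    have bound: "cmod (f z) \<le> B * cmod (f z) powr p" if z: "z \<in> ball z0 (d/2)" for z
    proof (cases "f z = 0")
      case False
      have 1: "d / 2 \<le> \<rho> - dist a z"
        using dist_triangle[of a z z0] z by (auto simp: d_def)
      have "cmod (f z) * (d/2) powr (2 / p) \<le> cmod (f z) * (\<rho> - dist a z) powr (2 / p)"
        using 1 d p by (intro mult_left_mono powr_mono2) auto
      also have "\<dots> \<le> N"
        using max[of z] 1 d by (simp add: h_def N_def)
      finally have "cmod (f z) \<le> N * (d / 2) powr (-(2 / p))"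
        using d by (simp add: powr_minus field_simps)
      then have "cmod (f z) powr (1 - p) \<le> B"
        unfolding B_def using p by (intro powr_mono2) auto
      then have "cmod (f z) powr (1 - p) * cmod (f z) powr p \<le> B * cmod (f z) powr p"
        by (intro mult_right_mono) auto
      then show ?thesis using False by (simp flip: powr_add)
    qed (simp add: B_def)
    have hol': "f holomorphic_on ball z0 (d/2)"
      using hol sub by (rule holomorphic_on_subset)
    have "(\<lambda>z. indicator (ball a r) z *\<^sub>R (cmod (f z) powr p)) \<in> borel_measurable borel"
      using p by (intro borel_measurable_continuous_on_indicator continuous_intros contf continuous_on_powr') auto
    then have "(\<lambda>z. ennreal (indicator (ball a r) z *\<^sub>R (cmod (f z) powr p))) \<in> borel_measurable borel"
      by measurable
    also have "(\<lambda>z. ennreal (indicator (ball a r) z *\<^sub>R (cmod (f z) powr p)))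
       = (\<lambda>z. ennreal (cmod (f z) powr p) * indicator (ball a r) z)"
      by (auto simp: indicator_def)
    finally have [measurable]: "(\<lambda>z. ennreal (cmod (f z) powr p) * indicator (ball a r) z) \<in> borel_measurable borel" .
    have "ennreal (pi * (d/2)\<^sup>2 * cmod (f z0)) \<le> (\<integral>\<^sup>+ z. ennreal (cmod (f z)) * indicator (ball z0 (d/2)) z \<partial>lborel)"
      using d by (intro area_mean_value_inequality hol') auto
    also have "\<dots> \<le> (\<integral>\<^sup>+ z. ennreal B * (ennreal (cmod (f z) powr p) * indicator (ball a r) z) \<partial>lborel)"
      using bound sub by (intro nn_integral_mono) (auto simp: indicator_def B_def simp flip: ennreal_mult intro!: ennreal_leI)
    also have "\<dots> = ennreal (B * J)"
      using J by (subst nn_integral_cmult) (auto simp: I_def B_def ennreal_mult)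
    finally have "pi * (d/2)\<^sup>2 * cmod (f z0) \<le> B * J"
      using J by (simp add: B_def)
    then have "pi * (d/2)\<^sup>2 * cmod (f z0) * (4 / pi * d powr (2 / p - 2)) \<le> B * J * (4 / pi * d powr (2 / p - 2))"
      by (intro mult_right_mono) auto
    also have "pi * (d/2)\<^sup>2 * cmod (f z0) * (4 / pi * d powr (2 / p - 2)) = N"
      using d by (simp add: N_def h_def d_def[symmetric] powr_diff power2_eq_square field_simps)
    also have "B * J * (4 / pi * d powr (2 / p - 2)) = A * N powr (1 - p) * J"
    proof -
      have "(d / 2) powr (-(2 / p) * (1 - p)) * d powr (2 / p - 2) = (1/2) powr (-(2 / p) * (1 - p))"
      proof -
        have "d powr (-(2 / p) * (1 - p)) * d powr (2 / p - 2) = d powr (-(2 / p) * (1 - p) + (2 / p - 2))"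
          by (rule powr_add[symmetric])
        also have "-(2 / p) * (1 - p) + (2 / p - 2) = 0"
          using p by (simp add: field_simps)
        finally show ?thesis
          using d by (simp only: powr_divide) (simp add: divide_simps)
      qed
      also have "\<dots> = 4 powr ((1 - p) / p)"
        using powr_powr[of 2 2 "(1 - p) / p"] by (simp add: powr_divide powr_minus powr_one_gt_zero_iff field_simps)
      finally have e: "(d / 2) powr (-(2 / p) * (1 - p)) * d powr (2 / p - 2) = 4 powr ((1 - p) / p)" .
      have "B = N powr (1 - p) * (d / 2) powr (-(2 / p) * (1 - p))"
        unfolding B_def using N d by (simp add: powr_mult powr_powr)
      then have "B * J * (4 / pi * d powr (2 / p - 2))
        = N powr (1 - p) * J * (4 / pi) * ((d / 2) powr (-(2 / p) * (1 - p)) * d powr (2 / p - 2))"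
        by (simp only: mult_ac)
      then show ?thesis unfolding e A_def by (simp only: mult_ac)
    qed
    finally have "N \<le> A * N powr (1 - p) * J" .
    then have "N powr p * N powr (1 - p) \<le> A * J * N powr (1 - p)"
      using N by (simp add: mult_ac flip: powr_add)
    then have NJ: "N powr p \<le> A * J" using N by simp
    have "(cmod (f a) * \<rho> powr (2 / p)) powr p \<le> N powr p"
      using fa p by (intro powr_mono2) auto
    then have "\<rho>\<^sup>2 * cmod (f a) powr p \<le> A * J"
      using NJ p \<rho> by (simp add: powr_mult powr_powr mult_ac)
    then have "r\<^sup>2 * cmod (f a) powr p \<le> 4 * A * J"
      by (simp add: \<rho>_def power2_eq_square)
    then show ?thesis
      using J by (simp add: I_def[symmetric] A_def flip: ennreal_mult)
  qed
qed

text \<open>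
For \<open>n > p\<close> the power \<open>f ^ n\<close> is again holomorphic, and \<open>|f| powr p\<close> is its modulus to the
exponent \<open>p / n < 1\<close>, to which the previous case applies.
\<close>

lemma power_mean_value_inequality:
  fixes p :: real
  assumes p: "0 < p"
  obtains C where "0 < C" "\<And>f a r. f holomorphic_on ball a r \<Longrightarrow> 0 < r \<Longrightarrow>
    ennreal (r\<^sup>2 * cmod (f a) powr p) \<le>
    ennreal C * (\<integral>\<^sup>+ z. ennreal (cmod (f z) powr p) * indicator (ball a r) z \<partial>lborel)"
proof -
  obtain n :: nat where n: "p < real n" using reals_Archimedean2 by blast
  define p' where "p' = p / n"
  have p': "0 < p'" "p' \<le> 1" using n p by (auto simp: p'_def)
  have pw: "cmod (x ^ n) powr p' = cmod x powr p" for x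
  proof (cases "x = 0")
    case False
    then have "cmod (x ^ n) = cmod x powr real n" by (simp add: norm_power powr_realpow)
    then show ?thesis using n p by (simp add: powr_powr p'_def)
  qed (use n p in auto)
  show ?thesis
  proof (rule that[of "4 * (4 / pi * 4 powr ((1 - p') / p'))"])
    fix f and a :: complex and r :: real
    assume "f holomorphic_on ball a r" "0 < r"
    then show "ennreal (r\<^sup>2 * cmod (f a) powr p) \<le> ennreal (4 * (4 / pi * 4 powr ((1 - p') / p'))) *
      (\<integral>\<^sup>+ z. ennreal (cmod (f z) powr p) * indicator (ball a r) z \<partial>lborel)"
      using power_mean_value_inequality_le_1[OF p', of "\<lambda>z. f z ^ n" a r]
      unfolding pw by (auto intro: holomorphic_intros)
  qed simp
qed

section \<open>Normalized area and the Forelli-Rudin estimate\<close>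

lemma nn_integral_area_measure:
  assumes "g \<in> borel_measurable (restrict_space borel unit_disk)"
  shows "(\<integral>\<^sup>+ z. g z \<partial>area_measure)
    = ennreal (1 / pi) * (\<integral>\<^sup>+ z. g z * indicator unit_disk z \<partial>lborel)"
proof -
  have "g \<in> borel_measurable (restrict_space lborel unit_disk)"
    using assms measurable_cong_sets[OF sets_restrict_space_cong[OF sets_lborel] refl] by blast
  then show ?thesis
    unfolding area_measure_def by (simp add: nn_integral_scale_measure nn_integral_restrict_space)
qed

lemma sets_area_measure [simp]: "sets area_measure = sets (restrict_space borel unit_disk)"
  using sets_restrict_space_cong[OF sets_lborel] by (simp add: area_measure_def)

lemma space_area_measure [simp]: "space area_measure = unit_disk"
  by (simp add: area_measure_def space_scale_measure space_restrict_space)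

lemma emeasure_area_measure:
  assumes "A \<in> sets borel" "A \<subseteq> unit_disk"
  shows "emeasure area_measure A = ennreal (1 / pi) * emeasure lborel A"
  using assms unfolding area_measure_def
  by (simp add: emeasure_restrict_space)

lemma finite_measure_area_measure: "finite_measure area_measure"
  by (rule finite_measureI)
     (simp add: emeasure_area_measure emeasure_ball unit_ball_vol_2 ennreal_mult_eq_top_iff)

text \<open>
Dyadic annuli: on \<open>2 ^ k \<le> |u| < 2 ^ Suc k\<close> the integrand is at most \<open>2 powr (-c*k)\<close>, the area at
most \<open>4 * pi * 4 ^ k\<close>, so \<open>c > 2\<close> gives a convergent geometric series.
\<close>

lemma nn_integral_norm_powr_outside_disk_finite:
  fixes c :: real
  assumes c: "2 < c"
  shows "(\<integral>\<^sup>+ u. ennreal (cmod u powr (-c)) * indicator (- ball 0 1) u \<partial>lborel) < \<infinity>"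
proof -
  have "(\<integral>\<^sup>+ u. ennreal (cmod u powr (-c)) * indicator (- ball 0 1) u \<partial>lborel)
    \<le> (\<integral>\<^sup>+ u. (\<Sum>k. ennreal ((2 ^ k) powr (-c)) * indicator (ball 0 (2 ^ Suc k)) u) \<partial>(lborel :: complex measure))"
  proof (rule nn_integral_mono)
    fix u :: complex
    show "ennreal (cmod u powr (-c)) * indicator (- ball 0 1) u
       \<le> (\<Sum>k. ennreal ((2 ^ k) powr (-c)) * indicator (ball 0 (2 ^ Suc k)) u)"
    proof (cases "cmod u < 1")
      case False
      obtain k where k: "2 ^ k \<le> cmod u" "cmod u < 2 ^ Suc k"
      proof -
        obtain m where m: "cmod u < 2 ^ m" using real_arch_pow[of 2 "cmod u"] by auto
        define n where "n = (LEAST m. cmod u < 2 ^ m)"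
        have n: "cmod u < 2 ^ n" unfolding n_def using m by (rule LeastI)
        then have "n \<noteq> 0" using False by (metis power_0)
        then obtain k where "n = Suc k" using not0_implies_Suc by blast
        moreover then have "\<not> cmod u < 2 ^ k"
          using not_less_Least[of k "\<lambda>m. cmod u < 2 ^ m"] by (simp add: n_def)
        ultimately show ?thesis using n that[of k] by auto
      qed
      have "cmod u powr (-c) \<le> (2 ^ k) powr (-c)"
        using k c by (intro powr_mono2') auto
      then have "ennreal (cmod u powr (-c)) * indicator (- ball 0 1) u
         \<le> ennreal ((2 ^ k) powr (-c)) * indicator (ball 0 (2 ^ Suc k)) u"
        using False k by (auto simp: indicator_def)
      also have "\<dots> \<le> (\<Sum>k. ennreal ((2 ^ k) powr (-c)) * indicator (ball 0 (2 ^ Suc k)) u)"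
      proof -
        have "a k \<le> suminf a" for a :: "nat \<Rightarrow> ennreal"
          using sum_le_suminf[of a "{k}"] by simp
        then show ?thesis .
      qed
      finally show ?thesis .
    qed simp
  qed
  also have "\<dots> = (\<Sum>k. ennreal ((2 ^ k) powr (-c)) * ennreal (pi * (2 ^ Suc k)\<^sup>2))"
  proof (subst nn_integral_suminf)
    show "(\<Sum>k. \<integral>\<^sup>+ u. ennreal ((2 ^ k) powr (-c)) * indicator (ball 0 (2 ^ Suc k)) u \<partial>(lborel :: complex measure))
      = (\<Sum>k. ennreal ((2 ^ k) powr (-c)) * ennreal (pi * (2 ^ Suc k)\<^sup>2))"
      by (simp only: nn_integral_cmult_indicator emeasure_ball unit_ball_vol_2 DIM_complex
          of_nat_numeral sets_lborel borel_open open_ball zero_le_power zero_le_numeral)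
  qed (intro borel_measurable_times_ennreal borel_measurable_const borel_measurable_indicator, simp)
  also have "\<dots> = (\<Sum>k. ennreal (4 * pi * (2 powr (2 - c)) ^ k))"
  proof (rule suminf_cong)
    fix k :: nat
    have "(2 ^ k) powr (-c) * (2 ^ k)\<^sup>2 = (2 powr (2 - c)) ^ k"
    proof -
      have "(2 ^ k) powr (-c) * (2 ^ k)\<^sup>2 = 2 powr (real k * (-c)) * 2 powr (real k * 2)"
        by (simp add: powr_powr flip: powr_realpow)
      also have "\<dots> = 2 powr (real k * (2 - c))"
        by (simp flip: powr_add) (simp add: algebra_simps)
      finally show ?thesis by (simp add: powr_power mult.commute)
    qed
    then have "(2 ^ k) powr (-c) * (pi * (2 ^ Suc k)\<^sup>2) = 4 * pi * (2 powr (2 - c)) ^ k"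
      by (simp add: power_mult_distrib mult_ac)
    then show "ennreal ((2 ^ k) powr (-c)) * ennreal (pi * (2 ^ Suc k)\<^sup>2) = ennreal (4 * pi * (2 powr (2 - c)) ^ k)"
      by (subst ennreal_mult[symmetric]) (simp_all only: powr_ge_zero mult_nonneg_nonneg pi_ge_zero zero_le_power2)
  qed
  also have "\<dots> < \<infinity>"
  proof -
    have "2 powr (2 - c) < 2 powr 0" using c by (subst powr_less_cancel_iff) auto
    then have "summable (\<lambda>k. 4 * pi * (2 powr (2 - c)) ^ k)"
      by (intro summable_mult summable_geometric) simp
    then show ?thesis by (simp add: suminf_ennreal2)
  qed
  finally show ?thesis .
qed

text \<open>
The Forelli-Rudin estimate. Up to the factor \<open>|z|\<close>, \<open>|1 - cnj z * w|\<close> is the distance from \<open>w\<close>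
to the reflected point \<open>1 / cnj z\<close>, which lies at distance \<open>(1 - |z|) / |z|\<close> from the disk. So
the integral is at most that of \<open>|u| powr (-c)\<close> over the outside of a disk of this radius,
and scaling to radius 1 produces the power of \<open>1 - |z|\<close>.
\<close>

lemma kernel_power_integral_bound:
  fixes c :: real
  assumes c: "2 < c"
  obtains C where "0 < C" "\<And>z. 1 / 2 \<le> cmod z \<Longrightarrow> cmod z < 1 \<Longrightarrow>
    (\<integral>\<^sup>+ w. ennreal (cmod (1 - cnj z * w) powr (-c)) \<partial>area_measure) \<le> ennreal (C * (1 - cmod z) powr (2 - c))"
proof -
  define J where "J = (\<integral>\<^sup>+ u. ennreal (cmod u powr (-c)) * indicator (- ball 0 1) (u :: complex) \<partial>lborel)"
  obtain K where K: "J = ennreal K" "0 \<le> K"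
    using nn_integral_norm_powr_outside_disk_finite[OF c] unfolding J_def[symmetric] by (cases J) auto
  show ?thesis
  proof (rule that[of "4 * K + 1"])
    show "0 < 4 * K + 1" using K by simp
    fix z :: complex assume z: "1 / 2 \<le> cmod z" "cmod z < 1"
    (* The mirror image of z in the unit circle, and its distance to the disk. *)
    define \<zeta> where "\<zeta> = 1 / cnj z"
    define \<eta> where "\<eta> = (1 - cmod z) / cmod z"
    have "0 < cmod z" using z by linarith
    then have z0: "z \<noteq> 0" and \<eta>: "0 < \<eta>" using z by (auto simp: \<eta>_def)
    have n\<zeta>: "cmod \<zeta> = 1 + \<eta>" using z0 by (simp add: \<zeta>_def \<eta>_def norm_divide diff_divide_distrib)
    have k: "cmod (1 - cnj z * w) = cmod z * cmod (w - \<zeta>)" for w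
    proof -
      have "1 - cnj z * w = cnj z * (\<zeta> - w)" using z0 by (simp add: \<zeta>_def right_diff_distrib)
      then show ?thesis by (simp add: norm_mult norm_minus_commute)
    qed
    have far: "\<eta> \<le> cmod (w - \<zeta>)" if "w \<in> unit_disk" for w
      using norm_triangle_ineq2[of \<zeta> w] n\<zeta> that by (simp add: norm_minus_commute)
    define g where "g = (\<lambda>u :: complex. ennreal (cmod u powr (-c)) * indicator (- ball 0 \<eta>) u)"
    have [measurable]: "g \<in> borel_measurable borel" unfolding g_def by measurable
    have "(\<integral>\<^sup>+ w. ennreal (cmod (1 - cnj z * w) powr (-c)) \<partial>area_measure)
      = ennreal (1 / pi) * (\<integral>\<^sup>+ w. ennreal (cmod (1 - cnj z * w) powr (-c)) * indicator unit_disk w \<partial>lborel)"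
      by (rule nn_integral_area_measure) (intro measurable_restrict_space1, measurable)
    also have "\<dots> \<le> ennreal (1 / pi) * (\<integral>\<^sup>+ w. ennreal (cmod z powr (-c)) * g (- \<zeta> + w) \<partial>lborel)"
      using far by (intro mult_left_mono nn_integral_mono)
        (auto simp: k g_def powr_mult ennreal_mult' indicator_def dist_norm not_less norm_minus_commute)
    also have "\<dots> = ennreal (1 / pi) * (ennreal (cmod z powr (-c)) * (\<integral>\<^sup>+ u. g u \<partial>lborel))"
      using nn_integral_lborel_shift[of g "- \<zeta>"] by (simp add: nn_integral_cmult)
    also have "(\<integral>\<^sup>+ u. g u \<partial>lborel) = ennreal (\<eta> powr (2 - c)) * J"
    proof -
      have "g (\<eta> *\<^sub>R u) = ennreal (\<eta> powr (-c)) * (ennreal (cmod u powr (-c)) * indicator (- ball 0 1) u)" for u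
      proof -
        have "\<eta> *\<^sub>R u \<in> ball 0 \<eta> \<longleftrightarrow> u \<in> ball 0 1" using \<eta> by simp
        moreover have "cmod (\<eta> *\<^sub>R u) powr (-c) = \<eta> powr (-c) * cmod u powr (-c)"
          using \<eta> by (simp add: powr_mult)
        ultimately show ?thesis
          unfolding g_def indicator_def by (simp only: ennreal_mult powr_ge_zero Compl_iff mult.assoc)
      qed
      then have "(\<integral>\<^sup>+ u. g u \<partial>lborel) = ennreal (\<eta>\<^sup>2) * (ennreal (\<eta> powr (-c)) * J)"
        using \<eta> by (subst nn_integral_lborel_scale[of _ \<eta>]) (simp_all add: nn_integral_cmult J_def)
      moreover have "\<eta>\<^sup>2 * \<eta> powr (-c) = \<eta> powr (2 - c)"
        using \<eta> by (simp add: powr_diff powr_minus field_simps)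
      moreover have "ennreal (\<eta>\<^sup>2) * (ennreal (\<eta> powr (-c)) * J) = ennreal (\<eta>\<^sup>2 * \<eta> powr (-c)) * J"
        by (simp add: ennreal_mult mult.assoc)
      ultimately show ?thesis by (simp only:)
    qed
    also have "ennreal (1 / pi) * (ennreal (cmod z powr (-c)) * (ennreal (\<eta> powr (2 - c)) * J))
      = ennreal (1 / pi * (cmod z powr (-c) * \<eta> powr (2 - c)) * K)"
      using K by (simp add: mult.assoc flip: ennreal_mult)
    also have "cmod z powr (-c) * \<eta> powr (2 - c) = (1 - cmod z) powr (2 - c) / (cmod z)\<^sup>2"
      using z z0 by (simp add: \<eta>_def powr_divide powr_diff powr_minus field_simps)
    also have "ennreal (1 / pi * ((1 - cmod z) powr (2 - c) / (cmod z)\<^sup>2) * K)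
       \<le> ennreal ((4 * K + 1) * (1 - cmod z) powr (2 - c))"
    proof (rule ennreal_leI)
      have "1 / 4 \<le> (cmod z)\<^sup>2" using power_mono[OF z(1), of 2] by (simp add: power2_eq_square)
      then have "1 / (cmod z)\<^sup>2 \<le> 4" using z0 by (simp add: field_simps)
      moreover have "1 / pi \<le> 1" using pi_ge_two by simp
      ultimately have "1 / pi * (1 / (cmod z)\<^sup>2) * ((1 - cmod z) powr (2 - c) * K) \<le> 1 * 4 * ((1 - cmod z) powr (2 - c) * K)"
        using K by (intro mult_mono) auto
      also have "\<dots> \<le> (4 * K + 1) * (1 - cmod z) powr (2 - c)" by (simp add: algebra_simps)
      finally show "1 / pi * ((1 - cmod z) powr (2 - c) / (cmod z)\<^sup>2) * K \<le> (4 * K + 1) * (1 - cmod z) powr (2 - c)"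
        by (simp add: mult_ac)
    qed
    finally show "(\<integral>\<^sup>+ w. ennreal (cmod (1 - cnj z * w) powr (-c)) \<partial>area_measure) \<le> ennreal ((4 * K + 1) * (1 - cmod z) powr (2 - c))" .
  qed
qed

section \<open>Pseudohyperbolic disks\<close>

text \<open>
The quantity \<open>1 - |z|\<^sup>2\<close> serves as the distance to the boundary: it is
comparable to \<open>1 - |z|\<close> and, up to a factor depending on the radius, constant on pseudohyperbolic disks.
\<close>

definition defect :: "complex \<Rightarrow> real" where
  "defect z = 1 - (cmod z)\<^sup>2"

lemma defect_pos: "z \<in> unit_disk \<Longrightarrow> 0 < defect z"
  by (simp add: defect_def abs_square_less_1)

lemma defect_bounds:
  assumes "z \<in> unit_disk"
  shows "1 - cmod z \<le> defect z" "defect z \<le> 2 * (1 - cmod z)"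
proof -
  have "defect z = (1 + cmod z) * (1 - cmod z)"
    by (simp add: defect_def power2_eq_square algebra_simps)
  moreover have "1 * (1 - cmod z) \<le> (1 + cmod z) * (1 - cmod z)" "(1 + cmod z) * (1 - cmod z) \<le> 2 * (1 - cmod z)"
    using assms by (intro mult_right_mono; simp)+
  ultimately show "1 - cmod z \<le> defect z" "defect z \<le> 2 * (1 - cmod z)" by simp_all
qed

lemma continuous_on_defect [continuous_intros]: "continuous_on S defect"
  unfolding defect_def by (intro continuous_intros)

lemma norm_one_minus_cnj_mult_commute: "cmod (1 - cnj z * w) = cmod (1 - cnj w * z)"
  by (metis complex_cnj_cnj complex_cnj_diff complex_cnj_mult complex_cnj_one complex_mod_cnj mult.commute)

lemma defect_le_norm_one_minus_cnj_mult:
  assumes "z \<in> unit_disk" "w \<in> unit_disk"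
  shows "defect z \<le> 2 * cmod (1 - cnj z * w)" "defect w \<le> 2 * cmod (1 - cnj z * w)"
proof -
  have *: "defect z \<le> 2 * cmod (1 - cnj z * w)" if "z \<in> unit_disk" "w \<in> unit_disk" for z w
  proof -
    have "cmod (cnj z * w) \<le> cmod z"
      using that mult_left_le[of "cmod w" "cmod z"] by (simp add: norm_mult)
    then have "1 - cmod z \<le> cmod (1 - cnj z * w)"
      using norm_triangle_ineq2[of 1 "cnj z * w"] by simp
    then show ?thesis using defect_bounds[OF that(1)] by simp
  qed
  show "defect z \<le> 2 * cmod (1 - cnj z * w)" "defect w \<le> 2 * cmod (1 - cnj z * w)"
    using *[OF assms] *[OF assms(2,1)] by (simp_all add: norm_one_minus_cnj_mult_commute)
qed

lemma norm_one_minus_cnj_mult_pos: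
  assumes "z \<in> unit_disk" "w \<in> unit_disk"
  shows "0 < cmod (1 - cnj z * w)"
  using defect_le_norm_one_minus_cnj_mult(1)[OF assms] defect_pos[OF assms(1)] by linarith

lemma mem_pseudohyperbolic_disk_iff:
  assumes "a \<in> unit_disk"
  shows "z \<in> pseudohyperbolic_disk a r \<longleftrightarrow> z \<in> unit_disk \<and> cmod (a - z) < r * cmod (1 - cnj a * z)"
  using norm_one_minus_cnj_mult_pos[OF assms, of z]
  by (auto simp: pseudohyperbolic_disk_def norm_divide divide_less_eq)

lemma pseudohyperbolic_disk_subset: "pseudohyperbolic_disk a r \<subseteq> unit_disk"
  by (auto simp: pseudohyperbolic_disk_def)

lemma mem_pseudohyperbolic_disk_commute:
  assumes "a \<in> unit_disk" "z \<in> pseudohyperbolic_disk a r"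
  shows "a \<in> pseudohyperbolic_disk z r"
proof -
  have z: "z \<in> unit_disk" using assms(2) pseudohyperbolic_disk_subset by blast
  then show ?thesis
    using assms by (simp add: mem_pseudohyperbolic_disk_iff norm_minus_commute norm_one_minus_cnj_mult_commute)
qed

lemma open_pseudohyperbolic_disk:
  assumes "a \<in> unit_disk"
  shows "open (pseudohyperbolic_disk a r)"
proof -
  have "pseudohyperbolic_disk a r = unit_disk \<inter> {z. cmod (a - z) < r * cmod (1 - cnj a * z)}"
    using mem_pseudohyperbolic_disk_iff[OF assms] by blast
  moreover have "open {z. cmod (a - z) < r * cmod (1 - cnj a * z)}"
    by (intro open_Collect_less continuous_intros)
  ultimately show ?thesis by (simp add: open_Int)
qed

context
  fixes a z :: complex and r :: real
  assumes a: "a \<in> unit_disk" and r: "0 < r" "r < 1" and z: "z \<in> pseudohyperbolic_disk a r"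
begin

lemma norm_one_minus_cnj_mult_le_defect: "cmod (1 - cnj a * z) \<le> defect a / (1 - r)"
proof -
  have "complex_of_real ((cmod a)\<^sup>2) = cnj a * a"
    by (metis complex_norm_square mult.commute of_real_power)
  then have "1 - cnj a * z = of_real (defect a) + cnj a * (a - z)"
    by (simp add: defect_def algebra_simps)
  then have "cmod (1 - cnj a * z) \<le> \<bar>defect a\<bar> + cmod a * cmod (a - z)"
    by (metis norm_triangle_ineq norm_mult norm_of_real complex_mod_cnj)
  also have "\<dots> \<le> defect a + 1 * (r * cmod (1 - cnj a * z))"
    using a z defect_pos[OF a] mem_pseudohyperbolic_disk_iff[OF a, of z r]
    by (intro add_mono mult_mono) auto
  finally show ?thesis using r by (simp add: field_simps)
qed

lemma norm_diff_less_defect: "cmod (a - z) < r / (1 - r) * defect a"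
proof -
  have "cmod (a - z) < r * cmod (1 - cnj a * z)"
    using z a by (simp add: mem_pseudohyperbolic_disk_iff)
  also have "\<dots> \<le> r * (defect a / (1 - r))"
    using norm_one_minus_cnj_mult_le_defect r by (intro mult_left_mono) auto
  finally show ?thesis by simp
qed

lemma defect_le_in_pseudohyperbolic_disk: "defect z \<le> 2 / (1 - r) * defect a"
proof -
  have "defect z \<le> 2 * cmod (1 - cnj a * z)"
    using defect_le_norm_one_minus_cnj_mult(2)[OF a subsetD[OF pseudohyperbolic_disk_subset z]] .
  then show ?thesis using norm_one_minus_cnj_mult_le_defect by simp
qed

end

lemma ball_subset_pseudohyperbolic_disk:
  assumes a: "a \<in> unit_disk" and r: "0 < r" "r < 1"
  shows "ball a (r * (1 - cmod a)) \<subseteq> pseudohyperbolic_disk a r"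
proof
  fix z assume z: "z \<in> ball a (r * (1 - cmod a))"
  have "r * (1 - cmod a) \<le> 1 - cmod a" using a r by (simp add: mult_left_le_one_le)
  then have zD: "z \<in> unit_disk"
    using z norm_triangle_ineq2[of z a] by (simp add: dist_norm norm_minus_commute)
  have "cmod (cnj a * z) \<le> cmod a"
    using zD mult_left_le[of "cmod z" "cmod a"] by (simp add: norm_mult)
  then have "1 - cmod a \<le> cmod (1 - cnj a * z)"
    using norm_triangle_ineq2[of 1 "cnj a * z"] by simp
  then have "r * (1 - cmod a) \<le> r * cmod (1 - cnj a * z)" using r by simp
  then show "z \<in> pseudohyperbolic_disk a r"
    using z zD a by (simp add: mem_pseudohyperbolic_disk_iff dist_norm)
qed

text \<open>
A crude form of the triangle inequality for the pseudohyperbolic distance is enough to bring points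
of a disk of small radius \<open>(1 - r) / 16\<close> from distance \<open>r\<close> of \<open>a\<close> to within \<open>(1 + r) / 2\<close>, the
radius at which a lattice has bounded overlap.
\<close>

lemma pseudohyperbolic_quasi_triangle:
  assumes a: "a \<in> unit_disk" and z: "z \<in> unit_disk" and r: "0 < r" "r < 1"
    and wa: "w \<in> pseudohyperbolic_disk a r" and wz: "w \<in> pseudohyperbolic_disk z ((1 - r) / 16)"
  shows "z \<in> pseudohyperbolic_disk a ((1 + r) / 2)"
proof -
  define s where "s = (1 - r) / 16"
  define X where "X = cmod (1 - cnj a * z)"
  define Y where "Y = cmod (w - z)"
  have s: "0 < s" "s < 1" using r by (auto simp: s_def)
  have w: "w \<in> unit_disk" using wa pseudohyperbolic_disk_subset by blast
  have "Y < s / (1 - s) * defect z"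
    using norm_diff_less_defect[OF z s] wz by (simp add: s_def Y_def norm_minus_commute)
  also have "\<dots> \<le> s / (1 - s) * (2 * X)"
    using s defect_le_norm_one_minus_cnj_mult(2)[OF a z] by (intro mult_left_mono) (auto simp: X_def)
  also have "\<dots> \<le> (1 - r) / 4 * X"
  proof -
    have "s / (1 - s) \<le> s / (1 / 2)" using s r by (intro divide_left_mono) (auto simp: s_def)
    also have "s / (1 / 2) = (1 - r) / 8" by (simp add: s_def)
    finally have "s / (1 - s) \<le> (1 - r) / 8" .
    then have "s / (1 - s) * (2 * X) \<le> (1 - r) / 8 * (2 * X)" by (intro mult_right_mono) (auto simp: X_def)
    then show ?thesis by (simp add: mult.commute)
  qed
  finally have Y: "Y < (1 - r) / 4 * X" .
  have "cmod (1 - cnj a * w) \<le> X + Y"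
  proof -
    (* Moving w to z changes 1 - cnj a * w by at most the small distance Y. *)
    have "1 - cnj a * w = (1 - cnj a * z) - cnj a * (w - z)" by (simp add: algebra_simps)
    then have "cmod (1 - cnj a * w) \<le> X + cmod a * Y"
      unfolding X_def Y_def by (metis norm_triangle_ineq4 norm_mult complex_mod_cnj)
    moreover have "cmod a * Y \<le> Y" using a by (simp add: Y_def mult_left_le_one_le)
    ultimately show ?thesis by simp
  qed
  moreover have "cmod (a - w) < r * cmod (1 - cnj a * w)"
    using wa a by (simp add: mem_pseudohyperbolic_disk_iff)
  ultimately have "cmod (a - w) \<le> r * (X + Y)"
    using r by (meson less_eq_real_def mult_left_mono order_trans less_imp_le)
  then have "cmod (a - z) \<le> r * (X + Y) + Y"
    using norm_triangle_ineq[of "a - w" "w - z"] by (simp add: Y_def)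
  also have "\<dots> \<le> r * X + 2 * Y"
    using mult_right_mono[of r 1 Y] r by (simp add: Y_def algebra_simps)
  also have "\<dots> < r * X + (1 - r) / 2 * X" using Y by simp
  also have "\<dots> = (1 + r) / 2 * X" by (simp add: field_simps)
  finally show ?thesis using a z by (simp add: mem_pseudohyperbolic_disk_iff X_def)
qed

text \<open>
The pseudohyperbolic disk lies between two Euclidean disks centred at \<open>a\<close> whose radii are comparable
to the defect of \<open>a\<close>.
\<close>

lemma measure_pseudohyperbolic_disk_bounds:
  assumes a: "a \<in> unit_disk" and r: "0 < r" "r < 1"
  shows "(r / 2)\<^sup>2 * (defect a)\<^sup>2 \<le> measure area_measure (pseudohyperbolic_disk a r)"
    and "measure area_measure (pseudohyperbolic_disk a r) \<le> (r / (1 - r))\<^sup>2 * (defect a)\<^sup>2"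
proof -
  define E where "E = pseudohyperbolic_disk a r"
  have E: "E \<in> sets borel" using open_pseudohyperbolic_disk[OF a] by (simp add: E_def)
  have d: "0 < defect a" using defect_pos[OF a] .
  have em: "emeasure area_measure E = ennreal (1 / pi) * emeasure lborel E"
    by (rule emeasure_area_measure[OF E]) (simp add: E_def pseudohyperbolic_disk_subset)
  have me: "emeasure area_measure E = ennreal (measure area_measure E)"
    using finite_measure.emeasure_eq_measure[OF finite_measure_area_measure] .
  have ba: "emeasure lborel (ball a s) = ennreal (pi * s\<^sup>2)" if "0 \<le> s" for s
    using that by (simp add: emeasure_ball unit_ball_vol_2)
  have "ennreal ((r / 2)\<^sup>2 * (defect a)\<^sup>2) = ennreal (1 / pi) * ennreal (pi * (r / 2 * defect a)\<^sup>2)"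
    by (simp add: power_mult_distrib power_divide flip: ennreal_mult)
  also have "\<dots> = ennreal (1 / pi) * emeasure lborel (ball a (r / 2 * defect a))"
    using r d by (subst ba) auto
  also have "\<dots> \<le> ennreal (1 / pi) * emeasure lborel E"
  proof (intro mult_left_mono emeasure_mono)
    have "r / 2 * defect a \<le> r / 2 * (2 * (1 - cmod a))"
      using r defect_bounds[OF a] by (intro mult_left_mono) auto
    then have "ball a (r / 2 * defect a) \<subseteq> ball a (r * (1 - cmod a))"
      by (intro subset_ball) (simp add: algebra_simps)
    then show "ball a (r / 2 * defect a) \<subseteq> E"
      using ball_subset_pseudohyperbolic_disk[OF a r] by (simp add: E_def)
  qed (use E in auto)
  finally show "(r / 2)\<^sup>2 * (defect a)\<^sup>2 \<le> measure area_measure (pseudohyperbolic_disk a r)"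
    unfolding em[symmetric] me E_def[symmetric] by simp
  have "ennreal (1 / pi) * emeasure lborel E \<le> ennreal (1 / pi) * emeasure lborel (ball a (r / (1 - r) * defect a))"
    using norm_diff_less_defect[OF a r] by (intro mult_left_mono emeasure_mono) (auto simp: E_def dist_norm)
  also have "\<dots> = ennreal (1 / pi) * ennreal (pi * (r / (1 - r) * defect a)\<^sup>2)"
    using r d by (subst ba) auto
  also have "\<dots> = ennreal ((r / (1 - r))\<^sup>2 * (defect a)\<^sup>2)"
    by (simp add: power_mult_distrib power_divide flip: ennreal_mult)
  finally show "measure area_measure (pseudohyperbolic_disk a r) \<le> (r / (1 - r))\<^sup>2 * (defect a)\<^sup>2"
    unfolding em[symmetric] me E_def[symmetric] by simp
qed

lemma eventually_to_boundary:
  "eventually P to_boundary \<longleftrightarrow> (\<exists>\<delta>>0. \<forall>z\<in>unit_disk. defect z < \<delta> \<longrightarrow> P z)"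
proof
  assume "eventually P to_boundary"
  then obtain Q where Q: "eventually Q (at_left (1::real))" "\<And>z. Q (cmod z) \<Longrightarrow> P z"
    unfolding to_boundary_def eventually_filtercomap by blast
  then obtain b where b: "b < 1" "\<And>y. b < y \<Longrightarrow> y < 1 \<Longrightarrow> Q y"
    unfolding eventually_at_left_field by blast
  have "\<forall>z\<in>unit_disk. defect z < 1 - b \<longrightarrow> P z"
  proof (intro ballI impI)
    fix z assume z: "z \<in> unit_disk" "defect z < 1 - b"
    then show "P z" using defect_bounds(1)[OF z(1)] by (intro Q(2) b(2)) auto
  qed
  then show "\<exists>\<delta>>0. \<forall>z\<in>unit_disk. defect z < \<delta> \<longrightarrow> P z" using b(1) by (intro exI[of _ "1 - b"]) auto
next
  assume "\<exists>\<delta>>0. \<forall>z\<in>unit_disk. defect z < \<delta> \<longrightarrow> P z"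
  then obtain \<delta> where \<delta>: "0 < \<delta>" "\<And>z. z \<in> unit_disk \<Longrightarrow> defect z < \<delta> \<Longrightarrow> P z" by blast
  have "eventually (\<lambda>y. 1 - \<delta> / 2 < y \<and> 0 < y \<and> y < 1) (at_left (1::real))"
    using \<delta> by (intro eventually_conj eventually_at_left_real eventually_at_leftI[of 0] order_tendstoD(1)[OF tendsto_ident_at]) auto
  then show "eventually P to_boundary"
    unfolding to_boundary_def eventually_filtercomap
  proof (intro exI conjI allI impI)
    fix z assume "1 - \<delta> / 2 < cmod z \<and> 0 < cmod z \<and> cmod z < 1"
    then show "P z" using defect_bounds(2)[of z] by (intro \<delta>(2)) auto
  qed
qed

lemma tendsto_0_to_boundary_iff:
  fixes f :: "complex \<Rightarrow> real"
  shows "(f \<longlongrightarrow> 0) to_boundary \<longleftrightarrow>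
    (\<forall>\<epsilon>>0. \<exists>\<delta>>0. \<forall>z\<in>unit_disk. defect z < \<delta> \<longrightarrow> \<bar>f z\<bar> < \<epsilon>)"
  by (simp add: tendsto_iff eventually_to_boundary)

section \<open>Lattices\<close>

text \<open>
A compact part of the disk is covered by finitely many disks \<open>E(x, (1+r)/2)\<close>, and by bounded
overlap each of them contains only finitely many lattice points.
\<close>

lemma lattice_tends_to_boundary:
  assumes lat: "lattice_in_disk r z" and r: "0 < r" "r < 1"
  shows "filterlim z to_boundary sequentially"
proof -
  have zD: "z k \<in> unit_disk" for k using lat unfolding lattice_in_disk_def by blast
  let ?R = "(1 + r) / 2"
  have fin: "finite {k. x \<in> pseudohyperbolic_disk (z k) ?R}" if "x \<in> unit_disk" for x
    using lat that by (auto simp: lattice_in_disk_def)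
  show ?thesis
    unfolding filterlim_iff eventually_to_boundary
  proof (intro allI impI)
    fix P assume "\<exists>\<delta>>0. \<forall>z\<in>unit_disk. defect z < \<delta> \<longrightarrow> P z"
    then obtain \<delta> where \<delta>: "0 < \<delta>" "\<And>z. z \<in> unit_disk \<Longrightarrow> defect z < \<delta> \<Longrightarrow> P z" by blast
    define K where "K = cball 0 1 \<inter> {x. \<delta> \<le> defect x}"
    have "closed {x. \<delta> \<le> defect x}" by (intro closed_Collect_le continuous_intros)
    then have "compact K" unfolding K_def by (intro compact_Int_closed compact_cball)
    moreover have KD: "K \<subseteq> unit_disk"
    proof
      fix x assume "x \<in> K"
      then have "(cmod x)\<^sup>2 < 1" using \<delta>(1) by (simp add: K_def defect_def)
      then show "x \<in> unit_disk" by (simp add: abs_square_less_1)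
    qed
    moreover have "K \<subseteq> (\<Union>x\<in>K. pseudohyperbolic_disk x ?R)"
    proof
      fix x assume x: "x \<in> K"
      then have "x \<in> pseudohyperbolic_disk x ?R"
        using KD r norm_one_minus_cnj_mult_pos[of x x] by (simp add: mem_pseudohyperbolic_disk_iff subset_iff)
      with x show "x \<in> (\<Union>x\<in>K. pseudohyperbolic_disk x ?R)" by blast
    qed
    ultimately obtain F where F: "F \<subseteq> K" "finite F" "K \<subseteq> (\<Union>x\<in>F. pseudohyperbolic_disk x ?R)"
      using compactE_image[of K K "\<lambda>x. pseudohyperbolic_disk x ?R"] open_pseudohyperbolic_disk by (metis subset_iff)
    have "finite (\<Union>x\<in>F. {k. x \<in> pseudohyperbolic_disk (z k) ?R})"
      using F KD fin by blast
    moreover have "{k. z k \<in> K} \<subseteq> (\<Union>x\<in>F. {k. x \<in> pseudohyperbolic_disk (z k) ?R})"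
    proof
      fix k assume "k \<in> {k. z k \<in> K}"
      then obtain x where x: "x \<in> F" "z k \<in> pseudohyperbolic_disk x ?R" using F(3) by blast
      then have "x \<in> pseudohyperbolic_disk (z k) ?R"
        using mem_pseudohyperbolic_disk_commute F(1) KD by (meson subsetD)
      with x(1) show "k \<in> (\<Union>x\<in>F. {k. x \<in> pseudohyperbolic_disk (z k) ?R})" by blast
    qed
    ultimately have "finite {k. z k \<in> K}" using finite_subset by blast
    then have "eventually (\<lambda>k. z k \<notin> K) sequentially"
      by (simp add: eventually_cofinite flip: cofinite_eq_sequentially)
    then show "eventually (\<lambda>k. P (z k)) sequentially"
    proof eventually_elim
      case (elim k)
      then show ?case using zD[of k] by (intro \<delta>(2)) (auto simp: K_def)
    qed
  qed
qed

text \<open>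
Rescaling \<open>E(w,R)\<close> by the defect of \<open>w\<close> maps it into a fixed Euclidean disk, and separated points
become Euclidean separated by a constant independent of \<open>w\<close>. Covering the fixed disk by finitely
many small balls bounds their number.
\<close>

lemma separated_points_in_pseudohyperbolic_disk_bounded:
  assumes r: "0 < r" and R: "0 < R" "R < 1"
  obtains N :: nat where "0 < N"
    "\<And>S w. w \<in> unit_disk \<Longrightarrow> S \<subseteq> unit_disk \<Longrightarrow>
      (\<And>a b. a \<in> S \<Longrightarrow> b \<in> S \<Longrightarrow> a \<noteq> b \<Longrightarrow> r * cmod (1 - cnj a * b) \<le> cmod (a - b)) \<Longrightarrow>
      finite (S \<inter> pseudohyperbolic_disk w R) \<and> card (S \<inter> pseudohyperbolic_disk w R) \<le> N"
proof -
  (* Rescaled points are at least 2 * e apart, so a ball of radius e contains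
     at most one of them. *)
  define e where "e = r * (1 - R) / 8"
  have e: "0 < e" using r R by (simp add: e_def)
  define B where "B = cball (0::complex) (R / (1 - R))"
  have "B \<subseteq> (\<Union>x\<in>B. ball x e)" using e by auto
  then obtain F where F: "F \<subseteq> B" "finite F" "B \<subseteq> (\<Union>x\<in>F. ball x e)"
    using compactE_image[of B B "\<lambda>x. ball x e"] unfolding B_def by (metis compact_cball open_ball)
  show ?thesis
  proof (rule that[of "Suc (card F)"])
    fix S w assume w: "w \<in> unit_disk" and S: "S \<subseteq> unit_disk"
      and sep: "\<And>a b. a \<in> S \<Longrightarrow> b \<in> S \<Longrightarrow> a \<noteq> b \<Longrightarrow> r * cmod (1 - cnj a * b) \<le> cmod (a - b)"
    define T where "T = S \<inter> pseudohyperbolic_disk w R"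
    have dw: "0 < defect w" using w by (rule defect_pos)
    define \<phi> where "\<phi> = (\<lambda>a. (w - a) /\<^sub>R defect w)"
    have "\<exists>x\<in>F. \<phi> a \<in> ball x e" if "a \<in> T" for a
    proof -
      have "cmod (w - a) < R / (1 - R) * defect w"
        using norm_diff_less_defect[OF w R] that by (simp add: T_def)
      then have "cmod (w - a) / defect w \<le> R / (1 - R)" using dw by (simp only: divide_le_eq if_True less_imp_le)
      moreover have "cmod (\<phi> a) = cmod (w - a) / defect w" using dw by (simp add: \<phi>_def divide_inverse_commute)
      ultimately have "\<phi> a \<in> B" by (simp add: B_def)
      then show ?thesis using F by blast
    qed
    then obtain g where g: "\<And>a. a \<in> T \<Longrightarrow> g a \<in> F \<and> \<phi> a \<in> ball (g a) e" by metis
    have "inj_on g T"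
    proof (rule inj_onI, rule ccontr)
      fix a b assume ab: "a \<in> T" "b \<in> T" "g a = g b" "a \<noteq> b"
      have wa: "w \<in> pseudohyperbolic_disk a R" and aD: "a \<in> unit_disk" and bD: "b \<in> unit_disk"
        using ab S w mem_pseudohyperbolic_disk_commute[OF w] by (auto simp: T_def)
      have "dist (\<phi> a) (\<phi> b) < 2 * e"
        using g[OF ab(1)] g[OF ab(2)] ab(3) dist_triangle_less_add[of "\<phi> a" "g a" e "\<phi> b" e] by (simp add: dist_commute)
      moreover have "dist (\<phi> a) (\<phi> b) = cmod (a - b) / defect w"
      proof -
        have "\<phi> a - \<phi> b = (b - a) /\<^sub>R defect w"
          by (simp add: \<phi>_def flip: scaleR_diff_right)
        then show ?thesis using dw by (simp add: dist_norm norm_minus_commute divide_inverse_commute)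
      qed
      ultimately have "cmod (a - b) < 2 * e * defect w" using dw by (simp add: divide_less_eq)
      also have "\<dots> \<le> 2 * e * (2 / (1 - R) * defect a)"
        using defect_le_in_pseudohyperbolic_disk[OF aD R wa] e by (intro mult_left_mono) auto
      also have "\<dots> = r / 2 * defect a" using R by (simp add: e_def divide_simps)
      also have "\<dots> \<le> r * cmod (1 - cnj a * b)"
        using defect_le_norm_one_minus_cnj_mult(1)[OF aD bD] r by simp
      also have "\<dots> \<le> cmod (a - b)" using sep ab by (simp add: T_def)
      finally show False by simp
    qed
    moreover have "g ` T \<subseteq> F" using g by blast
    ultimately show "finite T \<and> card T \<le> Suc (card F)"
      using F(2) by (metis card_inj_on_le finite_imageD finite_subset le_SucI)
  qed simp
qed

text \<open>
A maximal \<open>r\<close>-separated set covers the disk by maximality and has bounded overlap by the packing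
bound. It can be enumerated by the natural numbers, since it is countable by the
packing bound, and infinite because finitely many of the covering disks stay away from the boundary.
\<close>

lemma lattice_in_disk_exists:
  assumes r: "0 < r" "r < 1"
  obtains z where "lattice_in_disk r z"
proof -
  define sep where "sep = (\<lambda>a b. r * cmod (1 - cnj a * b) \<le> cmod (a - b))"
  define \<S> where "\<S> = {S. S \<subseteq> unit_disk \<and> (\<forall>a\<in>S. \<forall>b\<in>S. a \<noteq> b \<longrightarrow> sep a b)}"
  have sep_commute: "sep a b \<longleftrightarrow> sep b a" for a b
    by (simp add: sep_def norm_minus_commute norm_one_minus_cnj_mult_commute)
  have "\<exists>S\<in>\<S>. \<forall>X\<in>\<S>. S \<subseteq> X \<longrightarrow> X = S"
  proof (rule subset_Zorn')
    fix C assume C: "subset.chain \<S> C"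
    show "\<Union>C \<in> \<S>"
      unfolding \<S>_def
    proof (intro CollectI conjI ballI impI)
      show "\<Union>C \<subseteq> unit_disk" using C by (auto simp: subset_chain_def \<S>_def)
      fix a b assume ab: "a \<in> \<Union>C" "b \<in> \<Union>C" "a \<noteq> b"
      then obtain A B where AB: "A \<in> C" "B \<in> C" "a \<in> A" "b \<in> B" by blast
      then have "A \<subseteq> B \<or> B \<subseteq> A" using C by (auto simp: subset_chain_def)
      then obtain U where "U \<in> C" "a \<in> U" "b \<in> U" using AB by blast
      then show "sep a b" using C ab(3) by (auto simp: subset_chain_def \<S>_def)
    qed
  qed
  then obtain S where S: "S \<in> \<S>" and max: "\<And>X. X \<in> \<S> \<Longrightarrow> S \<subseteq> X \<Longrightarrow> X = S" by blast
  have SD: "S \<subseteq> unit_disk" and Ssep: "\<And>a b. a \<in> S \<Longrightarrow> b \<in> S \<Longrightarrow> a \<noteq> b \<Longrightarrow> r * cmod (1 - cnj a * b) \<le> cmod (a - b)"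
    using S by (auto simp: \<S>_def sep_def)
  have cover: "\<exists>a\<in>S. w \<in> pseudohyperbolic_disk a r" if w: "w \<in> unit_disk" for w
  proof (rule ccontr)
    assume no: "\<not> ?thesis"
    then have far: "sep a w" if "a \<in> S" for a
      using that w SD by (fastforce simp: mem_pseudohyperbolic_disk_iff subset_iff sep_def not_less)
    then have "insert w S \<in> \<S>"
      using S w sep_commute by (auto simp: \<S>_def)
    then have "w \<in> S" using max[of "insert w S"] by blast
    then have "r * cmod (1 - cnj w * w) \<le> 0" using far[of w] by (simp add: sep_def)
    then show False using norm_one_minus_cnj_mult_pos[OF w w] r by (simp add: mult_le_0_iff)
  qed
  have disk_eq: "(a \<in> pseudohyperbolic_disk w R) = (w \<in> pseudohyperbolic_disk a R)" if "a \<in> S" "w \<in> unit_disk" for a w R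
    using that SD mem_pseudohyperbolic_disk_commute[of a w R] mem_pseudohyperbolic_disk_commute[of w a R] by blast
  have count: "countable S"
  proof -
    have "S \<subseteq> (\<Union>n::nat. S \<inter> pseudohyperbolic_disk 0 (1 - 1 / (real n + 2)))"
    proof
      fix a assume a: "a \<in> S"
      then have "0 < 1 - cmod a" using SD by auto
      then obtain n :: nat where "inverse (real (Suc n)) < 1 - cmod a" using reals_Archimedean by blast
      moreover have "1 / (real n + 2) \<le> inverse (real (Suc n))" by (simp add: field_simps)
      ultimately have "cmod a < 1 - 1 / (real n + 2)" by simp
      then show "a \<in> (\<Union>n::nat. S \<inter> pseudohyperbolic_disk 0 (1 - 1 / (real n + 2)))"
        using a SD by (auto simp: mem_pseudohyperbolic_disk_iff subset_iff)
    qed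
    moreover have "finite (S \<inter> pseudohyperbolic_disk 0 (1 - 1 / (real n + 2)))" for n
      by (rule separated_points_in_pseudohyperbolic_disk_bounded[of r "1 - 1 / (real n + 2)"])
         (use r SD Ssep in auto)
    ultimately show ?thesis
      by (meson countable_UN countable_finite countable_subset uncountable_def countableI_type)
  qed
  have inf: "infinite S"
  proof
    assume "finite S"
    have "S \<noteq> {}" using cover[of 0] by auto
    define m where "m = Min (defect ` S)"
    have m: "0 < m" "\<And>a. a \<in> S \<Longrightarrow> m \<le> defect a"
      using \<open>finite S\<close> \<open>S \<noteq> {}\<close> SD defect_pos by (auto simp: m_def)
    (* A point so close to the boundary that any r-neighbour has defect below
       m, the smallest defect of the finitely many centres. *)
    define x where "x = complex_of_real (1 - min 1 (m * (1 - r) / 8))"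
    have x: "x \<in> unit_disk" "cmod x = 1 - min 1 (m * (1 - r) / 8)"
      using m(1) r unfolding x_def by (simp_all only: norm_of_real mem_ball_0) (auto simp: min_def)
    then obtain a where a: "a \<in> S" "x \<in> pseudohyperbolic_disk a r" using cover by blast
    then have "a \<in> pseudohyperbolic_disk x r" using disk_eq x(1) by blast
    then have "defect a \<le> 2 / (1 - r) * defect x" by (rule defect_le_in_pseudohyperbolic_disk[OF x(1) r])
    also have "\<dots> \<le> 2 / (1 - r) * (m * (1 - r) / 4)"
      using defect_bounds(2)[OF x(1)] x(2) r by (intro mult_left_mono) auto
    also have "\<dots> = m / 2" using r by simp
    finally show False using m a by force
  qed
  define z where "z = from_nat_into S"
  have bij: "bij_betw z UNIV S" unfolding z_def using count inf by (rule bij_betw_from_nat_into)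
  have zS: "range z = S" and zi: "inj z" using bij by (auto simp: bij_betw_def)
  define R where "R = (1 + r) / 2"
  have R: "0 < R" "R < 1" using r by (auto simp: R_def)
  obtain N :: nat where N: "0 < N" "\<And>w. w \<in> unit_disk \<Longrightarrow>
      finite (S \<inter> pseudohyperbolic_disk w R) \<and> card (S \<inter> pseudohyperbolic_disk w R) \<le> N"
    using separated_points_in_pseudohyperbolic_disk_bounded[OF r(1) R] SD Ssep by metis
  have "lattice_in_disk r z"
    unfolding lattice_in_disk_def R_def[symmetric]
  proof (intro conjI exI[of _ N] ballI N(1))
    show "range z \<subseteq> unit_disk" using zS SD by simp
    show "unit_disk \<subseteq> (\<Union>k. pseudohyperbolic_disk (z k) r)" using cover zS by fast
    fix w assume w: "w \<in> unit_disk"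
    have im: "z ` {k. w \<in> pseudohyperbolic_disk (z k) R} = S \<inter> pseudohyperbolic_disk w R"
      using zS disk_eq[OF _ w] by auto
    have inj: "inj_on z {k. w \<in> pseudohyperbolic_disk (z k) R}" using zi by (rule inj_on_subset) simp
    show "finite {k. w \<in> pseudohyperbolic_disk (z k) R}"
      using N(2)[OF w] im inj finite_imageD by metis
    show "card {k. w \<in> pseudohyperbolic_disk (z k) R} \<le> N"
      using N(2)[OF w] im card_image[OF inj] by metis
  qed
  then show ?thesis by (rule that)
qed

section \<open>Averaging over pseudohyperbolic disks\<close>

lemma borel_measurable_continuous_on_disk:
  fixes f :: "complex \<Rightarrow> 'b :: topological_space"
  assumes M: "sets M = sets (restrict_space borel unit_disk)" and f: "continuous_on unit_disk f"
  shows "f \<in> borel_measurable M"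
  using borel_measurable_continuous_on_restrict[OF f] measurable_cong_sets[OF M refl] by blast

text \<open>
The sub-mean value property on a Euclidean disk whose radius is proportional to the distance to the
boundary.
\<close>

lemma subaveraging_area_measure:
  fixes p R :: real
  assumes p: "0 < p" and R: "0 < R" "R \<le> 1"
  obtains C where "0 < C" "\<And>f w. f holomorphic_on unit_disk \<Longrightarrow> w \<in> unit_disk \<Longrightarrow>
    ennreal ((defect w)\<^sup>2 * cmod (f w) powr p) \<le> ennreal C *
      (\<integral>\<^sup>+ z. ennreal (cmod (f z) powr p) * indicator (ball w (R * (1 - cmod w))) z \<partial>area_measure)"
proof -
  obtain C where C: "0 < C" "\<And>f a r. f holomorphic_on ball a r \<Longrightarrow> 0 < r \<Longrightarrow>
    ennreal (r\<^sup>2 * cmod (f a) powr p) \<le>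
    ennreal C * (\<integral>\<^sup>+ z. ennreal (cmod (f z) powr p) * indicator (ball a r) z \<partial>lborel)"
    using power_mean_value_inequality[OF p] by metis
  show ?thesis
  proof (rule that[of "4 / R\<^sup>2 * (C * pi)"])
    show "0 < 4 / R\<^sup>2 * (C * pi)" using C R by simp
    fix f w assume f: "f holomorphic_on unit_disk" and w: "w \<in> unit_disk"
    define r where "r = R * (1 - cmod w)"
    have r: "0 < r" using R w by (simp add: r_def)
    have rle: "r \<le> 1 - cmod w" using R w by (simp add: r_def mult_left_le_one_le)
    have sub: "ball w r \<subseteq> unit_disk"
    proof
      fix x assume "x \<in> ball w r"
      then show "x \<in> unit_disk"
        using norm_triangle_ineq2[of x w] rle by (simp add: dist_norm norm_minus_commute)
    qed
    let ?g = "\<lambda>z. ennreal (cmod (f z) powr p) * indicator (ball w r) z"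
    have "continuous_on unit_disk (\<lambda>z. cmod (f z) powr p)"
      using p f by (intro continuous_on_powr' continuous_intros holomorphic_on_imp_continuous_on) auto
    then have m: "(\<lambda>z. cmod (f z) powr p) \<in> borel_measurable (restrict_space borel unit_disk)"
      by (rule borel_measurable_continuous_on_restrict)
    have ind: "indicator (ball w r) \<in> borel_measurable (restrict_space borel unit_disk)"
      by (intro measurable_restrict_space1 borel_measurable_indicator) simp
    have "?g \<in> borel_measurable (restrict_space borel unit_disk)"
      using m ind by measurable
    then have "(\<integral>\<^sup>+ z. ?g z \<partial>area_measure) = ennreal (1 / pi) * (\<integral>\<^sup>+ z. ?g z * indicator unit_disk z \<partial>lborel)"
      by (rule nn_integral_area_measure)
    also have "(\<integral>\<^sup>+ z. ?g z * indicator unit_disk z \<partial>lborel) = (\<integral>\<^sup>+ z. ?g z \<partial>lborel)"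
      using sub by (intro nn_integral_cong) (auto simp: indicator_def)
    finally have "ennreal pi * (\<integral>\<^sup>+ z. ?g z \<partial>area_measure) = ennreal (pi * (1 / pi)) * (\<integral>\<^sup>+ z. ?g z \<partial>lborel)"
      by (subst ennreal_mult) (auto simp: mult.assoc)
    then have A: "(\<integral>\<^sup>+ z. ?g z \<partial>lborel) = ennreal pi * (\<integral>\<^sup>+ z. ?g z \<partial>area_measure)" by simp
    have "(defect w)\<^sup>2 \<le> (2 * (1 - cmod w))\<^sup>2"
      using defect_bounds[OF w] defect_pos[OF w] by (intro power_mono) auto
    also have "\<dots> = 4 / R\<^sup>2 * r\<^sup>2" using R by (simp only: r_def power_mult_distrib) simp
    finally have "(defect w)\<^sup>2 * cmod (f w) powr p \<le> 4 / R\<^sup>2 * (r\<^sup>2 * cmod (f w) powr p)"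
      using mult_right_mono[of "(defect w)\<^sup>2" "4 / R\<^sup>2 * r\<^sup>2" "cmod (f w) powr p"] by (simp only: mult.assoc powr_ge_zero)
    then have "ennreal ((defect w)\<^sup>2 * cmod (f w) powr p) \<le> ennreal (4 / R\<^sup>2) * ennreal (r\<^sup>2 * cmod (f w) powr p)"
      by (simp add: ennreal_leI flip: ennreal_mult)
    also have "\<dots> \<le> ennreal (4 / R\<^sup>2) * (ennreal C * (\<integral>\<^sup>+ z. ?g z \<partial>lborel))"
      using C(2)[OF holomorphic_on_subset[OF f sub] r] by (intro mult_left_mono) auto
    also have "\<dots> = ennreal (4 / R\<^sup>2 * (C * pi)) * (\<integral>\<^sup>+ z. ?g z \<partial>area_measure)"
    proof -
      have e: "ennreal (k * (C * pi)) * X = ennreal k * (ennreal C * (ennreal pi * X))" if "0 \<le> k" for k X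
        using that C(1) by (simp add: ennreal_mult mult.assoc)
      show ?thesis unfolding A by (rule e[symmetric]) simp
    qed
    finally show "ennreal ((defect w)\<^sup>2 * cmod (f w) powr p) \<le> ennreal (4 / R\<^sup>2 * (C * pi)) *
      (\<integral>\<^sup>+ z. ennreal (cmod (f z) powr p) * indicator (ball w (R * (1 - cmod w))) z \<partial>area_measure)"
      unfolding r_def .
  qed
qed

lemma bergman_pointwise_growth:
  fixes p :: real
  assumes p: "0 < p"
  obtains C where "0 < C" "\<And>f K w. f holomorphic_on unit_disk \<Longrightarrow> 0 \<le> K \<Longrightarrow>
    (\<integral>\<^sup>+ z. ennreal (cmod (f z) powr p) \<partial>area_measure) \<le> ennreal K \<Longrightarrow> w \<in> unit_disk \<Longrightarrow>
    (defect w)\<^sup>2 * cmod (f w) powr p \<le> C * K"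
proof -
  obtain C where C: "0 < C" "\<And>f w. f holomorphic_on unit_disk \<Longrightarrow> w \<in> unit_disk \<Longrightarrow>
    ennreal ((defect w)\<^sup>2 * cmod (f w) powr p) \<le> ennreal C *
      (\<integral>\<^sup>+ z. ennreal (cmod (f z) powr p) * indicator (ball w (1 * (1 - cmod w))) z \<partial>area_measure)"
    using subaveraging_area_measure[OF p, of 1] by auto
  show ?thesis
  proof (rule that[OF C(1)])
    fix f w and K :: real assume f: "f holomorphic_on unit_disk" and w: "w \<in> unit_disk" and K: "0 \<le> K"
      and le: "(\<integral>\<^sup>+ z. ennreal (cmod (f z) powr p) \<partial>area_measure) \<le> ennreal K"
    have "ennreal ((defect w)\<^sup>2 * cmod (f w) powr p) \<le> ennreal C *
      (\<integral>\<^sup>+ z. ennreal (cmod (f z) powr p) * indicator (ball w (1 * (1 - cmod w))) z \<partial>area_measure)"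
      by (rule C(2)[OF f w])
    also have "\<dots> \<le> ennreal C * (\<integral>\<^sup>+ z. ennreal (cmod (f z) powr p) \<partial>area_measure)"
      by (intro mult_left_mono nn_integral_mono) (auto simp: indicator_def)
    also have "\<dots> \<le> ennreal C * ennreal K" using le by (intro mult_left_mono) auto
    also have "\<dots> = ennreal (C * K)" using C K by (simp add: ennreal_mult)
    finally show "(defect w)\<^sup>2 * cmod (f w) powr p \<le> C * K"
      using C K by (simp add: ennreal_le_iff)
  qed
qed

lemma finite_borel_measure_on_diskD:
  assumes "finite_borel_measure_on_disk \<Omega>"
  shows "sets \<Omega> = sets (restrict_space borel unit_disk)" "space \<Omega> = unit_disk" "finite_measure \<Omega>"
  using assms sets_eq_imp_space_eq[of \<Omega> "restrict_space borel unit_disk"]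
  by (auto simp: finite_borel_measure_on_disk_def space_restrict_space)

lemma pseudohyperbolic_disk_in_sets:
  assumes "finite_borel_measure_on_disk \<Omega>" "a \<in> unit_disk"
  shows "pseudohyperbolic_disk a r \<in> sets \<Omega>"
  using open_pseudohyperbolic_disk[OF assms(2), of r] pseudohyperbolic_disk_subset[of a r]
  unfolding finite_borel_measure_on_diskD(1)[OF assms(1)] by (subst sets_restrict_space_iff) auto

text \<open>
Bound \<open>|f w| powr q\<close> by an average over a Euclidean disk inside \<open>E(w,R)\<close>, integrate in \<open>w\<close>,
and swap the integrals. The points \<open>w\<close> whose disk contains a given \<open>z\<close> lie in \<open>E(z,R)\<close> by symmetry,
and there the defects of \<open>w\<close> and \<open>z\<close> are comparable.
\<close>

lemma nn_integral_powr_le_averaged_measure: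
  fixes q R :: real
  assumes q: "0 < q" and R: "0 < R" "R < 1"
  obtains C where "0 < C" "\<And>f \<Omega>. f holomorphic_on unit_disk \<Longrightarrow> finite_borel_measure_on_disk \<Omega> \<Longrightarrow>
    (\<integral>\<^sup>+ w. ennreal (cmod (f w) powr q) \<partial>\<Omega>) \<le> ennreal C *
      (\<integral>\<^sup>+ z. ennreal (cmod (f z) powr q / (defect z)\<^sup>2 * measure \<Omega> (pseudohyperbolic_disk z R)) \<partial>area_measure)"
proof -
  obtain C where C: "0 < C" "\<And>f w. f holomorphic_on unit_disk \<Longrightarrow> w \<in> unit_disk \<Longrightarrow>
    ennreal ((defect w)\<^sup>2 * cmod (f w) powr q) \<le> ennreal C *
      (\<integral>\<^sup>+ z. ennreal (cmod (f z) powr q) * indicator (ball w (R * (1 - cmod w))) z \<partial>area_measure)"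
    using subaveraging_area_measure[OF q R(1) less_imp_le[OF R(2)]] by blast
  define c where "c = 2 / (1 - R)"
  have c: "0 < c" using R by (simp add: c_def)
  show ?thesis
  proof (rule that[of "C * c\<^sup>2"])
    show "0 < C * c\<^sup>2" using C c by simp
    fix f \<Omega> assume f: "f holomorphic_on unit_disk" and \<Omega>: "finite_borel_measure_on_disk \<Omega>"
    note \<Omega>s = finite_borel_measure_on_diskD[OF \<Omega>]
    interpret O: finite_measure \<Omega> by (rule \<Omega>s(3))
    interpret A: finite_measure area_measure by (rule finite_measure_area_measure)
    interpret P: pair_sigma_finite \<Omega> area_measure ..
    have cf: "continuous_on unit_disk (\<lambda>z. cmod (f z) powr q)"
      using q f by (intro continuous_on_powr' continuous_intros holomorphic_on_imp_continuous_on) auto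
    define g where "g = (\<lambda>z. ennreal (cmod (f z) powr q / (defect z)\<^sup>2))"
    have "continuous_on unit_disk (\<lambda>z. cmod (f z) powr q / (defect z)\<^sup>2)"
      by (intro continuous_intros cf) (use defect_pos in fastforce)
    then have g [measurable]: "g \<in> borel_measurable area_measure"
      unfolding g_def by (intro measurable_compose[OF _ measurable_ennreal] borel_measurable_continuous_on_disk[of area_measure]) simp_all
    have F: "(\<lambda>z. ennreal (cmod (f z) powr q)) \<in> borel_measurable area_measure"
      using cf by (intro measurable_compose[OF _ measurable_ennreal] borel_measurable_continuous_on_disk[of area_measure]) simp_all
    (* The average over the Euclidean disk about w, written on the product space. *)
    define G where "G = (\<lambda>w z. if dist w z < R * (1 - cmod w) then g z else 0)"
    have G [measurable]: "(\<lambda>x. G (fst x) (snd x)) \<in> borel_measurable (\<Omega> \<Otimes>\<^sub>M area_measure)"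
    proof -
      have i1: "(\<lambda>x. x) \<in> borel_measurable \<Omega>"
        by (rule borel_measurable_continuous_on_disk[OF \<Omega>s(1)]) (rule continuous_on_id)
      have i2: "(\<lambda>x. x) \<in> borel_measurable area_measure"
        by (rule borel_measurable_continuous_on_disk) (simp_all add: continuous_on_id)
      have [measurable]: "(\<lambda>x. fst x) \<in> borel_measurable (\<Omega> \<Otimes>\<^sub>M area_measure)"
        by (rule measurable_compose[OF measurable_fst i1])
      have [measurable]: "(\<lambda>x. snd x) \<in> borel_measurable (\<Omega> \<Otimes>\<^sub>M area_measure)"
        by (rule measurable_compose[OF measurable_snd i2])
      have [measurable]: "(\<lambda>x. g (snd x)) \<in> borel_measurable (\<Omega> \<Otimes>\<^sub>M area_measure)"
        by (rule measurable_compose[OF measurable_snd g])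
      show ?thesis unfolding G_def by measurable
    qed
    have bound: "ennreal (cmod (f w) powr q) \<le> ennreal (C * c\<^sup>2) * (\<integral>\<^sup>+ z. G w z \<partial>area_measure)" if w: "w \<in> unit_disk" for w
    proof -
      have dw: "0 < defect w" using w by (rule defect_pos)
      let ?I = "\<lambda>z. ennreal (cmod (f z) powr q) * indicator (ball w (R * (1 - cmod w))) z"
      have ind: "indicator (ball w (R * (1 - cmod w))) \<in> borel_measurable area_measure"
        using measurable_restrict_space1[of "indicator (ball w (R * (1 - cmod w)))" borel borel unit_disk]
          measurable_cong_sets[OF sets_area_measure refl] by (metis borel_measurable_indicator borel_open open_ball)
      have I: "?I \<in> borel_measurable area_measure" using F ind by measurable
      have "ennreal (cmod (f w) powr q) = ennreal (1 / (defect w)\<^sup>2) * ennreal ((defect w)\<^sup>2 * cmod (f w) powr q)"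
        using dw by (simp flip: ennreal_mult)
      also have "\<dots> \<le> ennreal (1 / (defect w)\<^sup>2) * (ennreal C * (\<integral>\<^sup>+ z. ?I z \<partial>area_measure))"
        by (intro mult_left_mono C(2) f w) auto
      also have "\<dots> = ennreal C * (\<integral>\<^sup>+ z. ennreal (1 / (defect w)\<^sup>2) * ?I z \<partial>area_measure)"
        by (subst nn_integral_cmult[OF I]) (simp add: mult_ac)
      also have "\<dots> \<le> ennreal C * (\<integral>\<^sup>+ z. ennreal (c\<^sup>2) * G w z \<partial>area_measure)"
      proof (intro mult_left_mono nn_integral_mono)
        fix z assume "z \<in> space area_measure"
        then have z: "z \<in> unit_disk" by simp
        show "ennreal (1 / (defect w)\<^sup>2) * ?I z \<le> ennreal (c\<^sup>2) * G w z"
        proof (cases "dist w z < R * (1 - cmod w)")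
          case True
          then have "z \<in> pseudohyperbolic_disk w R"
            using ball_subset_pseudohyperbolic_disk[OF w R] by auto
          then have "defect z \<le> c * defect w"
            unfolding c_def by (rule defect_le_in_pseudohyperbolic_disk[OF w R])
          then have "(defect z)\<^sup>2 \<le> (c * defect w)\<^sup>2"
            using defect_pos[OF z] by (intro power_mono) auto
          then have "1 / (defect w)\<^sup>2 \<le> c\<^sup>2 / (defect z)\<^sup>2"
            using dw defect_pos[OF z] by (simp add: power_mult_distrib divide_simps mult_ac)
          then have "1 / (defect w)\<^sup>2 * cmod (f z) powr q \<le> c\<^sup>2 / (defect z)\<^sup>2 * cmod (f z) powr q"
            by (rule mult_right_mono) simp
          also have "\<dots> = c\<^sup>2 * (cmod (f z) powr q / (defect z)\<^sup>2)" by simp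
          finally show ?thesis
            using True by (simp add: G_def g_def ennreal_leI flip: ennreal_mult)
        qed (simp add: G_def)
      qed simp
      also have "\<dots> = ennreal C * (ennreal (c\<^sup>2) * (\<integral>\<^sup>+ z. G w z \<partial>area_measure))"
      proof -
        have "(\<lambda>z. G w z) \<in> borel_measurable area_measure"
          using measurable_compose[OF measurable_Pair1' G, of w] w \<Omega>s(2) by simp
        then show ?thesis by (simp add: nn_integral_cmult)
      qed
      also have "\<dots> = ennreal (C * c\<^sup>2) * (\<integral>\<^sup>+ z. G w z \<partial>area_measure)"
        using C by (simp add: ennreal_mult mult.assoc)
      finally show ?thesis .
    qed
    have "(\<integral>\<^sup>+ w. ennreal (cmod (f w) powr q) \<partial>\<Omega>) \<le> (\<integral>\<^sup>+ w. ennreal (C * c\<^sup>2) * (\<integral>\<^sup>+ z. G w z \<partial>area_measure) \<partial>\<Omega>)"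
      using bound \<Omega>s(2) by (intro nn_integral_mono) auto
    also have "\<dots> = ennreal (C * c\<^sup>2) * (\<integral>\<^sup>+ w. (\<integral>\<^sup>+ z. G w z \<partial>area_measure) \<partial>\<Omega>)"
      by (rule nn_integral_cmult) measurable
    also have "(\<integral>\<^sup>+ w. (\<integral>\<^sup>+ z. G w z \<partial>area_measure) \<partial>\<Omega>) = (\<integral>\<^sup>+ z. (\<integral>\<^sup>+ w. G w z \<partial>\<Omega>) \<partial>area_measure)"
      by (rule P.Fubini'[symmetric]) (use G in \<open>simp add: split_beta'\<close>)
    also have "\<dots> \<le> (\<integral>\<^sup>+ z. ennreal (cmod (f z) powr q / (defect z)\<^sup>2 * measure \<Omega> (pseudohyperbolic_disk z R)) \<partial>area_measure)"
    proof (rule nn_integral_mono)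
      fix z assume "z \<in> space area_measure"
      then have z: "z \<in> unit_disk" by simp
      have "(\<integral>\<^sup>+ w. G w z \<partial>\<Omega>) \<le> (\<integral>\<^sup>+ w. g z * indicator (pseudohyperbolic_disk z R) w \<partial>\<Omega>)"
      proof (rule nn_integral_mono)
        fix w assume "w \<in> space \<Omega>"
        then have w: "w \<in> unit_disk" using \<Omega>s(2) by simp
        show "G w z \<le> g z * indicator (pseudohyperbolic_disk z R) w"
          using ball_subset_pseudohyperbolic_disk[OF w R] mem_pseudohyperbolic_disk_commute[OF w, of z R]
          by (auto simp: G_def indicator_def)
      qed
      also have "\<dots> = g z * emeasure \<Omega> (pseudohyperbolic_disk z R)"
        by (rule nn_integral_cmult_indicator) (rule pseudohyperbolic_disk_in_sets[OF \<Omega> z])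
      also have "\<dots> = ennreal (cmod (f z) powr q / (defect z)\<^sup>2 * measure \<Omega> (pseudohyperbolic_disk z R))"
        by (simp add: g_def O.emeasure_eq_measure flip: ennreal_mult)
      finally show "(\<integral>\<^sup>+ w. G w z \<partial>\<Omega>) \<le> ennreal (cmod (f z) powr q / (defect z)\<^sup>2 * measure \<Omega> (pseudohyperbolic_disk z R))" .
    qed
    finally show "(\<integral>\<^sup>+ w. ennreal (cmod (f w) powr q) \<partial>\<Omega>) \<le> ennreal (C * c\<^sup>2) *
      (\<integral>\<^sup>+ z. ennreal (cmod (f z) powr q / (defect z)\<^sup>2 * measure \<Omega> (pseudohyperbolic_disk z R)) \<partial>area_measure)"
      by (simp add: mult_left_mono)
  qed
qed

section \<open>Small disk masses give vanishing Carleson measures\<close>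

text \<open>
With \<open>\<gamma> = 2q/p\<close>, this is the averaging condition after removing the weight and
replacing the area of the pseudohyperbolic disk by the square of the defect.
\<close>

definition vanishing_disk_mass :: "real \<Rightarrow> real \<Rightarrow> complex measure \<Rightarrow> bool" where
  "vanishing_disk_mass \<gamma> R \<Omega> \<longleftrightarrow>
     ((\<lambda>z. measure \<Omega> (pseudohyperbolic_disk z R) / defect z powr \<gamma>) \<longlongrightarrow> 0) to_boundary"

lemma vanishing_disk_mass_iff:
  "vanishing_disk_mass \<gamma> R \<Omega> \<longleftrightarrow> (\<forall>\<epsilon>>0. \<exists>\<delta>>0. \<forall>z\<in>unit_disk. defect z < \<delta> \<longrightarrow>
     measure \<Omega> (pseudohyperbolic_disk z R) < \<epsilon> * defect z powr \<gamma>)"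
proof -
  have "\<bar>measure \<Omega> (pseudohyperbolic_disk z R) / defect z powr \<gamma>\<bar> < \<epsilon> \<longleftrightarrow>
      measure \<Omega> (pseudohyperbolic_disk z R) < \<epsilon> * defect z powr \<gamma>" if "z \<in> unit_disk" for z \<epsilon>
    using defect_pos[OF that] by (simp add: divide_less_eq)
  then show ?thesis
    unfolding vanishing_disk_mass_def tendsto_0_to_boundary_iff by (intro all_cong ex_cong conj_cong refl) auto
qed

lemma tendsto_0_ennrealI:
  fixes f :: "'a \<Rightarrow> ennreal"
  assumes "\<And>\<epsilon>. 0 < \<epsilon> \<Longrightarrow> eventually (\<lambda>x. f x \<le> ennreal \<epsilon>) F"
  shows "(f \<longlongrightarrow> 0) F"
proof (rule order_tendstoI)
  fix a :: ennreal assume "0 < a"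
  then obtain b where b: "0 < b" "b < a" using dense by blast
  then obtain e where e: "b = ennreal e" "0 < e" by (cases b) auto
  show "eventually (\<lambda>x. f x < a) F"
    using assms[OF e(2)] by eventually_elim (use b e in auto)
qed simp

text \<open>
Positivity at the end point 1 matters here: together with continuity it keeps the weight away from 0.
\<close>

lemma weight_bounds:
  assumes "weight \<sigma>"
  obtains m M where "0 < m" "\<And>x. x \<in> {0..1} \<Longrightarrow> m \<le> \<sigma> x" "\<And>x. x \<in> {0..1} \<Longrightarrow> \<sigma> x \<le> M"
proof -
  from assms have "C2_on_unit_interval \<sigma>" and pos: "\<And>x. x \<in> {0..1} \<Longrightarrow> 0 < \<sigma> x"
    by (auto simp: weight_def)
  then obtain \<sigma>' where "\<And>x. x \<in> {0..1} \<Longrightarrow> (\<sigma> has_real_derivative \<sigma>' x) (at x within {0..1})"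
    unfolding C2_on_unit_interval_def by blast
  then have c: "continuous_on {0..1} \<sigma>" by (rule DERIV_continuous_on)
  obtain x where x: "x \<in> {0..1}" "\<And>y. y \<in> {0..1} \<Longrightarrow> \<sigma> x \<le> \<sigma> y"
    using continuous_attains_inf[OF compact_Icc _ c] by auto
  obtain y where y: "y \<in> {0..1}" "\<And>z. z \<in> {0..1} \<Longrightarrow> \<sigma> z \<le> \<sigma> y"
    using continuous_attains_sup[OF compact_Icc _ c] by auto
  show ?thesis using that[of "\<sigma> x" "\<sigma> y"] x y pos by blast
qed

lemma bergman_integral_ge:
  assumes "0 < m" "\<And>x. x \<in> {0..1} \<Longrightarrow> m \<le> \<sigma> x" "f holomorphic_on unit_disk" "0 < p"
  shows "ennreal m * (\<integral>\<^sup>+ z. ennreal (cmod (f z) powr p) \<partial>area_measure) \<le> bergman_integral p \<sigma> f"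
proof -
  have "continuous_on unit_disk (\<lambda>z. cmod (f z) powr p)"
    using assms by (intro continuous_on_powr' continuous_intros holomorphic_on_imp_continuous_on) auto
  then have "(\<lambda>z. ennreal (cmod (f z) powr p)) \<in> borel_measurable area_measure"
    by (intro measurable_compose[OF _ measurable_ennreal] borel_measurable_continuous_on_disk[of area_measure]) simp_all
  then have "ennreal m * (\<integral>\<^sup>+ z. ennreal (cmod (f z) powr p) \<partial>area_measure)
     = (\<integral>\<^sup>+ z. ennreal m * ennreal (cmod (f z) powr p) \<partial>area_measure)"
    by (rule nn_integral_cmult[symmetric])
  also have "\<dots> \<le> bergman_integral p \<sigma> f"
    unfolding bergman_integral_def
  proof (rule nn_integral_mono)
    fix z assume "z \<in> space area_measure"
    then have "m \<le> \<sigma> (cmod z)" by (intro assms(2)) auto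
    then have "m * cmod (f z) powr p \<le> cmod (f z) powr p * \<sigma> (cmod z)"
      by (simp add: mult.commute[of m] mult_left_mono)
    then show "ennreal m * ennreal (cmod (f z) powr p) \<le> ennreal (cmod (f z) powr p * \<sigma> (cmod z))"
      using assms(1) by (simp add: ennreal_leI flip: ennreal_mult)
  qed
  finally show ?thesis .
qed

text \<open>
Split the averaged integral at \<open>defect z = \<delta>\<close>. Where the defect is small,
\<open>|f| powr q * defect powr (\<gamma> - 2)\<close> is at most a multiple of \<open>|f| powr p\<close> by the growth bound, since
\<open>\<gamma> - 2 = 2 * (q - p) / p\<close>; the remaining part of the disk is compact.
\<close>

lemma vanishing_disk_mass_imp_vanishing_bergman_carleson:
  fixes p q R :: real
  assumes \<sigma>: "weight \<sigma>" and \<Omega>: "finite_borel_measure_on_disk \<Omega>"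
    and p: "0 < p" and pq: "p \<le> q" and R: "0 < R" "R < 1"
    and van: "vanishing_disk_mass (2 * q / p) R \<Omega>"
  shows "vanishing_bergman_carleson p q \<sigma> \<Omega>"
  unfolding vanishing_bergman_carleson_def
proof (intro allI impI)
  fix f :: "nat \<Rightarrow> complex \<Rightarrow> complex"
  assume fb: "\<forall>n. f n \<in> bergman_space p \<sigma>" and "\<exists>C. \<forall>n. bergman_norm p \<sigma> (f n) \<le> C"
    and unif: "\<forall>K. compact K \<and> K \<subseteq> unit_disk \<longrightarrow> uniform_limit K f (\<lambda>_. 0) sequentially"
  then obtain C0 where C0: "\<And>n. bergman_norm p \<sigma> (f n) \<le> C0" by blast
  have q: "0 < q" using p pq by simp
  define \<gamma> where "\<gamma> = 2 * q / p"
  interpret O: finite_measure \<Omega> using finite_borel_measure_on_diskD(3)[OF \<Omega>] .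
  obtain m where m: "0 < m" "\<And>x. x \<in> {0..1} \<Longrightarrow> m \<le> \<sigma> x" using weight_bounds[OF \<sigma>] by metis
  have hol: "f n holomorphic_on unit_disk" for n using fb by (auto simp: bergman_space_def)
  define K where "K = C0 powr p / m"
  have K0: "0 \<le> K" using m by (simp add: K_def)
  have K: "(\<integral>\<^sup>+ z. ennreal (cmod (f n z) powr p) \<partial>area_measure) \<le> ennreal K" for n
  proof -
    have "bergman_integral p \<sigma> (f n) < \<infinity>" using fb by (auto simp: bergman_space_def)
    then obtain x where x: "bergman_integral p \<sigma> (f n) = ennreal x" "0 \<le> x"
      by (cases "bergman_integral p \<sigma> (f n)") auto
    then have "x powr (1 / p) \<le> C0" using C0[of n] by (simp add: bergman_norm_def)
    then have "(x powr (1 / p)) powr p \<le> C0 powr p" using p by (intro powr_mono2) auto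
    then have xC: "x \<le> C0 powr p" using x p by (simp add: powr_powr)
    have "ennreal m * (\<integral>\<^sup>+ z. ennreal (cmod (f n z) powr p) \<partial>area_measure) \<le> ennreal x"
      using bergman_integral_ge[where \<sigma>=\<sigma>, OF m(1) m(2) hol[of n] p] x by simp
    also have "\<dots> \<le> ennreal m * ennreal K"
      using xC m K0 by (simp add: K_def ennreal_leI flip: ennreal_mult)
    finally show ?thesis using m by (simp add: ennreal_mult_le_mult_iff)
  qed
  obtain C1 where C1: "0 < C1" "\<And>f K w. f holomorphic_on unit_disk \<Longrightarrow> 0 \<le> K \<Longrightarrow>
    (\<integral>\<^sup>+ z. ennreal (cmod (f z) powr p) \<partial>area_measure) \<le> ennreal K \<Longrightarrow> w \<in> unit_disk \<Longrightarrow>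
    (defect w)\<^sup>2 * cmod (f w) powr p \<le> C1 * K"
    using bergman_pointwise_growth[OF p] by blast
  obtain C2 where C2: "0 < C2" "\<And>f \<Omega>. f holomorphic_on unit_disk \<Longrightarrow> finite_borel_measure_on_disk \<Omega> \<Longrightarrow>
    (\<integral>\<^sup>+ w. ennreal (cmod (f w) powr q) \<partial>\<Omega>) \<le> ennreal C2 *
      (\<integral>\<^sup>+ z. ennreal (cmod (f z) powr q / (defect z)\<^sup>2 * measure \<Omega> (pseudohyperbolic_disk z R)) \<partial>area_measure)"
    using nn_integral_powr_le_averaged_measure[OF q R] by blast
  define B where "B = (C1 * K) powr ((q - p) / p)"
  have B0: "0 \<le> B" by (simp add: B_def)
  (* This is where q \<ge> p enters: the surplus |f| powr (q - p) is paid for by the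
     factor defect powr (\<gamma> - 2). *)
  have growth: "cmod (f n z) powr q * defect z powr (\<gamma> - 2) \<le> B * cmod (f n z) powr p" if z: "z \<in> unit_disk" for n z
  proof (cases "f n z = 0")
    case False
    have "((defect z)\<^sup>2 * cmod (f n z) powr p) powr ((q - p) / p) \<le> B"
      unfolding B_def using C1(2)[OF hol K0 K z] p pq by (intro powr_mono2) auto
    also have "((defect z)\<^sup>2 * cmod (f n z) powr p) powr ((q - p) / p) = defect z powr (\<gamma> - 2) * cmod (f n z) powr (q - p)"
    proof -
      have "(defect z)\<^sup>2 = defect z powr 2" using defect_pos[OF z] by simp
      moreover have "2 * ((q - p) / p) = \<gamma> - 2" using p by (simp add: \<gamma>_def field_simps)
      ultimately show ?thesis using p by (simp add: powr_mult powr_powr)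
    qed
    finally have "defect z powr (\<gamma> - 2) * cmod (f n z) powr (q - p) * cmod (f n z) powr p \<le> B * cmod (f n z) powr p"
      by (rule mult_right_mono) simp
    moreover have "cmod (f n z) powr (q - p) * cmod (f n z) powr p = cmod (f n z) powr q"
      using False by (simp flip: powr_add)
    ultimately show ?thesis by (simp only: mult.assoc mult.commute[of "cmod (f n z) powr q"])
  qed simp
  have A1: "emeasure area_measure unit_disk = 1"
    by (simp add: emeasure_area_measure emeasure_ball unit_ball_vol_2 flip: ennreal_mult)
  show "(\<lambda>n. \<integral>\<^sup>+ w. ennreal (cmod (f n w) powr q) \<partial>\<Omega>) \<longlonglongrightarrow> 0"
  proof (rule tendsto_0_ennrealI)
    fix \<epsilon> :: real assume \<epsilon>: "0 < \<epsilon>"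
    (* Chosen so that the boundary part contributes at most \<epsilon> / 2. *)
    define e1 where "e1 = \<epsilon> / (2 * C2 * (B * K + 1))"
    have e1: "0 < e1" using \<epsilon> C2 B0 K0 by (auto simp: e1_def intro!: divide_pos_pos mult_pos_pos add_nonneg_pos)
    obtain \<delta> where \<delta>: "0 < \<delta>" "\<And>z. z \<in> unit_disk \<Longrightarrow> defect z < \<delta> \<Longrightarrow>
       measure \<Omega> (pseudohyperbolic_disk z R) < e1 * defect z powr \<gamma>"
      using van e1 unfolding vanishing_disk_mass_iff \<gamma>_def by blast
    define T where "T = measure \<Omega> unit_disk"
    have T: "measure \<Omega> A \<le> T" for A
      using O.bounded_measure[of A] finite_borel_measure_on_diskD(2)[OF \<Omega>] by (simp add: T_def)
    have T0: "0 \<le> T" by (simp add: T_def)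
    (* Chosen so that the compact part contributes at most \<epsilon> / 2. *)
    define e3 where "e3 = \<epsilon> * \<delta>\<^sup>2 / (2 * C2 * (T + 1))"
    have e3: "0 < e3" using \<epsilon> \<delta> C2 T0 by (auto simp: e3_def intro!: divide_pos_pos mult_pos_pos add_nonneg_pos)
    define L where "L = cball 0 1 \<inter> {z. \<delta> \<le> defect z}"
    have "closed {z. \<delta> \<le> defect z}" by (intro closed_Collect_le continuous_intros)
    then have "compact L" unfolding L_def by (intro compact_Int_closed compact_cball)
    moreover have "L \<subseteq> unit_disk"
    proof
      fix x assume "x \<in> L"
      then have "(cmod x)\<^sup>2 < 1" using \<delta>(1) by (simp add: L_def defect_def)
      then show "x \<in> unit_disk" by (simp add: abs_square_less_1)
    qed
    ultimately have "uniform_limit L f (\<lambda>_. 0) sequentially" using unif by blast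
    then have "eventually (\<lambda>n. \<forall>x\<in>L. dist (f n x) 0 < e3 powr (1 / q)) sequentially"
      using e3 by (intro uniform_limitD) auto
    then show "eventually (\<lambda>n. (\<integral>\<^sup>+ w. ennreal (cmod (f n w) powr q) \<partial>\<Omega>) \<le> ennreal \<epsilon>) sequentially"
    proof eventually_elim
      case (elim n)
      have bd: "cmod (f n z) powr q / (defect z)\<^sup>2 * measure \<Omega> (pseudohyperbolic_disk z R)
          \<le> e1 * B * cmod (f n z) powr p + e3 / \<delta>\<^sup>2 * T" if z: "z \<in> unit_disk" for z
      proof (cases "defect z < \<delta>")
        case True
        have dz: "0 < defect z" using defect_pos[OF z] .
        have "cmod (f n z) powr q / (defect z)\<^sup>2 * measure \<Omega> (pseudohyperbolic_disk z R)
          \<le> cmod (f n z) powr q / (defect z)\<^sup>2 * (e1 * defect z powr \<gamma>)"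
          using \<delta>(2)[OF z True] by (intro mult_left_mono) auto
        also have "\<dots> = e1 * (cmod (f n z) powr q * defect z powr (\<gamma> - 2))"
          using dz by (simp add: powr_diff)
        also have "\<dots> \<le> e1 * (B * cmod (f n z) powr p)"
          using growth[OF z] e1 by (intro mult_left_mono) auto
        also have "\<dots> \<le> e1 * B * cmod (f n z) powr p + e3 / \<delta>\<^sup>2 * T" using e3 T0 by simp
        finally show ?thesis .
      next
        case False
        then have "z \<in> L" using z by (auto simp: L_def)
        then have "cmod (f n z) \<le> e3 powr (1 / q)" using elim by force
        then have "cmod (f n z) powr q \<le> (e3 powr (1 / q)) powr q" using q by (intro powr_mono2) auto
        then have "cmod (f n z) powr q \<le> e3" using q e3 by (simp add: powr_powr)
        moreover have "\<delta>\<^sup>2 \<le> (defect z)\<^sup>2" using False \<delta>(1) by (intro power_mono) auto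
        ultimately have "cmod (f n z) powr q / (defect z)\<^sup>2 \<le> e3 / \<delta>\<^sup>2"
          using \<delta>(1) e3 by (intro frac_le) auto
        then have "cmod (f n z) powr q / (defect z)\<^sup>2 * measure \<Omega> (pseudohyperbolic_disk z R) \<le> e3 / \<delta>\<^sup>2 * T"
          using T e3 by (intro mult_mono) auto
        also have "\<dots> \<le> e1 * B * cmod (f n z) powr p + e3 / \<delta>\<^sup>2 * T" using e1 B0 by simp
        finally show ?thesis .
      qed
      have cf: "continuous_on unit_disk (\<lambda>z. cmod (f n z) powr p)"
        using p hol[of n] by (intro continuous_on_powr' continuous_intros holomorphic_on_imp_continuous_on) auto
      have mf: "(\<lambda>z. ennreal (cmod (f n z) powr p)) \<in> borel_measurable area_measure"
        using cf by (intro measurable_compose[OF _ measurable_ennreal] borel_measurable_continuous_on_disk[of area_measure]) simp_all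
      have "(\<integral>\<^sup>+ w. ennreal (cmod (f n w) powr q) \<partial>\<Omega>) \<le> ennreal C2 *
        (\<integral>\<^sup>+ z. ennreal (cmod (f n z) powr q / (defect z)\<^sup>2 * measure \<Omega> (pseudohyperbolic_disk z R)) \<partial>area_measure)"
        by (rule C2(2)[OF hol \<Omega>])
      also have "\<dots> \<le> ennreal C2 * (\<integral>\<^sup>+ z. (ennreal (e1 * B) * ennreal (cmod (f n z) powr p) + ennreal (e3 / \<delta>\<^sup>2 * T)) \<partial>area_measure)"
      proof (intro mult_left_mono nn_integral_mono)
        fix z assume "z \<in> space area_measure"
        then have "z \<in> unit_disk" by simp
        from ennreal_leI[OF bd[OF this]] show "ennreal (cmod (f n z) powr q / (defect z)\<^sup>2 * measure \<Omega> (pseudohyperbolic_disk z R))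
           \<le> ennreal (e1 * B) * ennreal (cmod (f n z) powr p) + ennreal (e3 / \<delta>\<^sup>2 * T)"
          using e1 B0 e3 T0 by (simp add: ennreal_mult ennreal_plus)
      qed simp
      also have "\<dots> = ennreal C2 * (ennreal (e1 * B) * (\<integral>\<^sup>+ z. ennreal (cmod (f n z) powr p) \<partial>area_measure) + ennreal (e3 / \<delta>\<^sup>2 * T))"
        using mf A1 by (simp add: nn_integral_add nn_integral_cmult)
      also have "\<dots> \<le> ennreal C2 * (ennreal (e1 * B) * ennreal K + ennreal (e3 / \<delta>\<^sup>2 * T))"
        by (intro mult_left_mono add_right_mono K) auto
      also have "\<dots> = ennreal (C2 * (e1 * B * K + e3 / \<delta>\<^sup>2 * T))"
        using C2 e1 B0 K0 e3 T0 by (simp add: ennreal_mult ennreal_plus)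
      also have "\<dots> \<le> ennreal \<epsilon>"
      proof (rule ennreal_leI)
        have BK: "0 \<le> B * K" using B0 K0 by simp
        have "C2 * (e1 * B * K) = \<epsilon> / 2 * (B * K / (B * K + 1))"
          using C2 by (simp add: e1_def)
        also have "\<dots> \<le> \<epsilon> / 2 * 1" using \<epsilon> BK by (intro mult_left_mono) auto
        finally have 1: "C2 * (e1 * B * K) \<le> \<epsilon> / 2" by simp
        have "C2 * (e3 / \<delta>\<^sup>2 * T) = \<epsilon> / 2 * (T / (T + 1))"
          using C2 \<delta>(1) by (simp add: e3_def)
        also have "\<dots> \<le> \<epsilon> / 2 * 1" using \<epsilon> T0 by (intro mult_left_mono) auto
        finally have 2: "C2 * (e3 / \<delta>\<^sup>2 * T) \<le> \<epsilon> / 2" by simp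
        show "C2 * (e1 * B * K + e3 / \<delta>\<^sup>2 * T) \<le> \<epsilon>" unfolding distrib_left using 1 2 by linarith
      qed
      finally show ?case .
    qed
  qed
qed

section \<open>Kernel test functions and the Berezin transform\<close>

text \<open>
Up to a power of the defect of \<open>z\<close>, this is the Berezin transform with \<open>s = (\<alpha> + 2) * t\<close>.
\<close>

definition kernel_potential :: "real \<Rightarrow> complex measure \<Rightarrow> complex \<Rightarrow> real" where
  "kernel_potential s \<Omega> z = (\<integral>w. cmod (1 - cnj z * w) powr (-s) \<partial>\<Omega>)"

lemma norm_powr_of_real:
  assumes "z \<noteq> 0"
  shows "cmod (z powr complex_of_real c) = cmod z powr c"
  using assms by (simp add: powr_def norm_exp_eq_Re)

lemma norm_normalized_kernel_powr:
  assumes "z \<in> unit_disk" "w \<in> unit_disk"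
  shows "cmod (normalized_kernel \<alpha> z w) powr t
    = defect z powr ((\<alpha> + 2) * t / 2) * cmod (1 - cnj z * w) powr (- ((\<alpha> + 2) * t))"
proof -
  have d: "0 < defect z" by (rule defect_pos[OF assms(1)])
  have "complex_of_real ((cmod z)\<^sup>2) = cnj z * z"
    by (metis complex_norm_square mult.commute of_real_power)
  then have "1 - cnj z * z = of_real (defect z)"
    by (simp add: defect_def)
  then have "bergman_kernel \<alpha> z z = of_real (defect z) powr of_real (- (\<alpha> + 2))"
    unfolding bergman_kernel_def by simp
  also have "\<dots> = of_real (defect z powr (- (\<alpha> + 2)))"
    by (rule powr_of_real) (use d in auto)
  finally have 1: "cmod (csqrt (bergman_kernel \<alpha> z z)) = defect z powr (- (\<alpha> + 2) / 2)"
    by (simp only: csqrt_of_real[OF powr_ge_zero] norm_of_real powr_half_sqrt_powr[OF less_imp_le[OF d]]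
        abs_of_nonneg[OF real_sqrt_ge_zero[OF powr_ge_zero]])
  have "cmod (1 - cnj w * z) \<noteq> 0" using norm_one_minus_cnj_mult_pos[OF assms(2,1)] by simp
  then have "1 - cnj w * z \<noteq> 0" by simp
  then have "cmod (bergman_kernel \<alpha> z w) = cmod (1 - cnj w * z) powr (- (\<alpha> + 2))"
    unfolding bergman_kernel_def of_real_minus[symmetric] by (rule norm_powr_of_real)
  then have 2: "cmod (bergman_kernel \<alpha> z w) = cmod (1 - cnj z * w) powr (- (\<alpha> + 2))"
    by (simp add: norm_one_minus_cnj_mult_commute)
  have "cmod (normalized_kernel \<alpha> z w) = defect z powr ((\<alpha> + 2) / 2) * cmod (1 - cnj z * w) powr (- (\<alpha> + 2))"
  proof -
    have "defect z powr (- (\<alpha> + 2) / 2) = inverse (defect z powr ((\<alpha> + 2) / 2))"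
      unfolding minus_divide_left[symmetric] by (rule powr_minus)
    then have "a / defect z powr (- (\<alpha> + 2) / 2) = defect z powr ((\<alpha> + 2) / 2) * a" for a
      by (simp only: divide_inverse inverse_inverse_eq mult.commute)
    then show ?thesis
      by (simp only: normalized_kernel_def norm_divide 1 2)
  qed
  moreover have "(\<alpha> + 2) / 2 * t = (\<alpha> + 2) * t / 2" "- (\<alpha> + 2) * t = - ((\<alpha> + 2) * t)"
    by (simp_all add: algebra_simps)
  ultimately show ?thesis
    by (simp only: powr_mult powr_powr powr_ge_zero)
qed

lemma berezin_transform_eq_kernel_potential:
  assumes "finite_borel_measure_on_disk \<Omega>" "z \<in> unit_disk"
  shows "berezin_transform \<alpha> t \<Omega> z = defect z powr ((\<alpha> + 2) * t / 2) * kernel_potential ((\<alpha> + 2) * t) \<Omega> z"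
proof -
  have "berezin_transform \<alpha> t \<Omega> z
     = (\<integral>w. defect z powr ((\<alpha> + 2) * t / 2) * cmod (1 - cnj z * w) powr (- ((\<alpha> + 2) * t)) \<partial>\<Omega>)"
    unfolding berezin_transform_def
    by (rule Bochner_Integration.integral_cong[OF refl])
       (simp only: finite_borel_measure_on_diskD(2)[OF assms(1)] norm_normalized_kernel_powr[OF assms(2)])
  then show ?thesis by (simp add: kernel_potential_def)
qed

lemma integrable_kernel_power:
  assumes \<Omega>: "finite_borel_measure_on_disk \<Omega>" and z: "z \<in> unit_disk" and s: "0 \<le> s"
  shows "integrable \<Omega> (\<lambda>w. cmod (1 - cnj z * w) powr (-s))"
proof -
  interpret O: finite_measure \<Omega> using finite_borel_measure_on_diskD(3)[OF \<Omega>] .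
  have pos: "0 < cmod (1 - cnj z * w)" if "w \<in> unit_disk" for w
    by (rule norm_one_minus_cnj_mult_pos[OF z that])
  show ?thesis
  proof (rule O.integrable_const_bound)
    show "AE w in \<Omega>. norm (cmod (1 - cnj z * w) powr (-s)) \<le> (defect z / 2) powr (-s)"
    proof (rule AE_I2)
      fix w assume "w \<in> space \<Omega>"
      then have w: "w \<in> unit_disk" using finite_borel_measure_on_diskD(2)[OF \<Omega>] by simp
      show "norm (cmod (1 - cnj z * w) powr (-s)) \<le> (defect z / 2) powr (-s)"
        using defect_le_norm_one_minus_cnj_mult(1)[OF z w] defect_pos[OF z] s by (simp add: powr_mono2')
    qed
    have "continuous_on unit_disk (\<lambda>w. cmod (1 - cnj z * w) powr (-s))"
      using pos by (intro continuous_on_powr continuous_intros) fastforce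
    then show "(\<lambda>w. cmod (1 - cnj z * w) powr (-s)) \<in> borel_measurable \<Omega>"
      by (rule borel_measurable_continuous_on_disk[OF finite_borel_measure_on_diskD(1)[OF \<Omega>]])
  qed
qed

text \<open>
On \<open>E(z,R)\<close> the kernel \<open>|1 - cnj z * w|\<close> is at most \<open>defect z / (1 - R)\<close>.
\<close>

lemma disk_mass_le_kernel_potential:
  assumes \<Omega>: "finite_borel_measure_on_disk \<Omega>" and z: "z \<in> unit_disk" and R: "0 < R" "R < 1" and s: "0 \<le> s"
  shows "measure \<Omega> (pseudohyperbolic_disk z R) \<le> (1 - R) powr (-s) * (defect z powr s * kernel_potential s \<Omega> z)"
proof -
  interpret O: finite_measure \<Omega> using finite_borel_measure_on_diskD(3)[OF \<Omega>] .
  let ?E = "pseudohyperbolic_disk z R"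
  have E: "?E \<in> sets \<Omega>" by (rule pseudohyperbolic_disk_in_sets[OF \<Omega> z])
  have d: "0 < defect z" by (rule defect_pos[OF z])
  have "(defect z / (1 - R)) powr (-s) * measure \<Omega> ?E = (\<integral>w. (defect z / (1 - R)) powr (-s) * indicator ?E w \<partial>\<Omega>)"
    using E by simp
  also have "\<dots> \<le> kernel_potential s \<Omega> z"
    unfolding kernel_potential_def
  proof (rule integral_mono)
    show "integrable \<Omega> (\<lambda>w. (defect z / (1 - R)) powr (-s) * indicator ?E w)"
      using E by (intro integrable_mult_right) (simp add: O.emeasure_finite less_top[symmetric])
    show "integrable \<Omega> (\<lambda>w. cmod (1 - cnj z * w) powr (-s))" by (rule integrable_kernel_power[OF \<Omega> z s])
    fix w assume "w \<in> space \<Omega>"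
    then have w: "w \<in> unit_disk" using finite_borel_measure_on_diskD(2)[OF \<Omega>] by simp
    show "(defect z / (1 - R)) powr (-s) * indicator ?E w \<le> cmod (1 - cnj z * w) powr (-s)"
    proof (cases "w \<in> ?E")
      case True
      then show ?thesis
        using norm_one_minus_cnj_mult_le_defect[OF z R True] norm_one_minus_cnj_mult_pos[OF z w] s
        by (simp add: powr_mono2')
    qed simp
  qed
  finally have "(1 - R) powr (-s) * (defect z powr s * ((defect z / (1 - R)) powr (-s) * measure \<Omega> ?E))
     \<le> (1 - R) powr (-s) * (defect z powr s * kernel_potential s \<Omega> z)"
    by (intro mult_left_mono) auto
  also have "(1 - R) powr (-s) * (defect z powr s * ((defect z / (1 - R)) powr (-s) * measure \<Omega> ?E)) = measure \<Omega> ?E"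
    using d R by (simp add: powr_divide powr_minus)
  finally show ?thesis .
qed

text \<open>
If the limit fails there are points \<open>Z n\<close> tending to the boundary where the expression stays above
some \<open>\<epsilon>\<close>. The scaled kernel powers at these points violate the Carleson condition: they are bounded in the
Bergman space, tend to 0 locally uniformly, and their integrals are exactly the values of the
expression at \<open>Z n\<close>.
\<close>

lemma vanishing_bergman_carleson_imp_kernel_potential:
  fixes p q s :: real
  assumes \<sigma>: "weight \<sigma>" and \<Omega>: "finite_borel_measure_on_disk \<Omega>"
    and p: "0 < p" and q: "0 < q" and s: "2 * q / p < s"
    and van: "vanishing_bergman_carleson p q \<sigma> \<Omega>"
  shows "((\<lambda>z. defect z powr (s - 2 * q / p) * kernel_potential s \<Omega> z) \<longlongrightarrow> 0) to_boundary"
proof (rule ccontr)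
  obtain M where bounds: "\<And>x. x \<in> {0..1} \<Longrightarrow> \<sigma> x \<le> M" using weight_bounds[OF \<sigma>] by metis
  define \<gamma> where "\<gamma> = 2 * q / p"
  have s0: "0 < s" using s p q by (smt (verit) divide_pos_pos)
  define \<Phi> where "\<Phi> = (\<lambda>z. defect z powr (s - \<gamma>) * kernel_potential s \<Omega> z)"
  have \<Phi>0: "0 \<le> \<Phi> z" for z by (simp add: \<Phi>_def kernel_potential_def)
  assume "\<not> ?thesis"
  then have "\<exists>\<epsilon>>0. \<forall>\<delta>>0. \<exists>z\<in>unit_disk. defect z < \<delta> \<and> \<epsilon> \<le> \<Phi> z"
    unfolding \<gamma>_def[symmetric] \<Phi>_def[symmetric] tendsto_0_to_boundary_iff abs_of_nonneg[OF \<Phi>0]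
      not_less[symmetric] by blast
  then obtain \<epsilon> where \<epsilon>: "0 < \<epsilon>" "\<And>\<delta>. 0 < \<delta> \<Longrightarrow> \<exists>z\<in>unit_disk. defect z < \<delta> \<and> \<epsilon> \<le> \<Phi> z" by blast
  have "\<forall>n::nat. \<exists>z\<in>unit_disk. defect z < 1 / (real n + 2) \<and> \<epsilon> \<le> \<Phi> z" using \<epsilon>(2) by simp
  then obtain Z where Z: "\<And>n. Z n \<in> unit_disk" "\<And>n. defect (Z n) < 1 / (real n + 2)" "\<And>n. \<epsilon> \<le> \<Phi> (Z n)"
    by metis
  have dZ: "0 < defect (Z n)" for n using defect_pos[OF Z(1)] .
  have Zh: "1 / 2 \<le> cmod (Z n)" for n
  proof -
    have "1 / (real n + 2) \<le> 1 / 2" by simp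
    then have "1 / 4 \<le> (cmod (Z n))\<^sup>2" using Z(2)[of n] unfolding defect_def by linarith
    then have "(1 / 2)\<^sup>2 \<le> (cmod (Z n))\<^sup>2" by (simp only: power_one_over) simp
    then show ?thesis by (rule power2_le_imp_le) simp
  qed
  have Z0: "(\<lambda>n. defect (Z n)) \<longlonglongrightarrow> 0"
  proof (rule tendsto_sandwich[OF _ _ tendsto_const])
    show "eventually (\<lambda>n. 0 \<le> defect (Z n)) sequentially" using dZ by (simp add: less_imp_le)
    show "eventually (\<lambda>n. defect (Z n) \<le> 1 / (real n + 2)) sequentially" using Z(2) by (simp add: less_imp_le)
    show "(\<lambda>n. 1 / (real n + 2)) \<longlonglongrightarrow> 0" by real_asymp
  qed
  (* The scaling makes |f n| powr q equal to the kernel power -s times the factor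
     defect powr (s - \<gamma>). *)
  define f where "f = (\<lambda>n w. of_real (defect (Z n) powr ((s - \<gamma>) / q)) * (1 - cnj (Z n) * w) powr of_real (- (s / q)))"
  have nf: "cmod (f n w) = defect (Z n) powr ((s - \<gamma>) / q) * cmod (1 - cnj (Z n) * w) powr (- (s / q))" if "w \<in> unit_disk" for n w
    using norm_one_minus_cnj_mult_pos[OF Z(1) that, of n] unfolding f_def norm_mult
    by (subst norm_powr_of_real) auto
  have hol: "f n holomorphic_on unit_disk" for n
  proof -
    have "1 - cnj (Z n) * w \<notin> \<real>\<^sub>\<le>\<^sub>0" if "w \<in> unit_disk" for w
    proof -
      have "cmod (cnj (Z n) * w) < 1"
        using Z(1)[of n] that mult_strict_mono[of "cmod (Z n)" 1 "cmod w" 1] by (simp add: norm_mult)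
      then have "Re (cnj (Z n) * w) < 1" using complex_Re_le_cmod[of "cnj (Z n) * w"] by simp
      then show ?thesis by (auto simp: complex_nonpos_Reals_iff)
    qed
    then show ?thesis unfolding f_def by (intro holomorphic_intros) auto
  qed
  define c where "c = s * p / q"
  have c: "2 < c" using s p q by (simp add: c_def field_simps)
  obtain C where C: "0 < C" "\<And>z. 1 / 2 \<le> cmod z \<Longrightarrow> cmod z < 1 \<Longrightarrow>
    (\<integral>\<^sup>+ w. ennreal (cmod (1 - cnj z * w) powr (-c)) \<partial>area_measure) \<le> ennreal (C * (1 - cmod z) powr (2 - c))"
    using kernel_power_integral_bound[OF c] by blast
  have "0 < \<sigma> 0" using \<sigma> by (simp add: weight_def)
  then have M: "0 < M" using bounds[of 0] by simp
  define K where "K = M * (C * 2 powr (c - 2))"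
  have K: "bergman_integral p \<sigma> (f n) \<le> ennreal K" for n
  proof -
    define A where "A = M * defect (Z n) powr (c - 2)"
    have A: "0 \<le> A" using M by (simp add: A_def)
    have "bergman_integral p \<sigma> (f n) \<le> (\<integral>\<^sup>+ w. ennreal A * ennreal (cmod (1 - cnj (Z n) * w) powr (-c)) \<partial>area_measure)"
      unfolding bergman_integral_def
    proof (rule nn_integral_mono)
      fix w assume "w \<in> space area_measure"
      then have w: "w \<in> unit_disk" by simp
      have "(s - \<gamma>) / q * p = c - 2" using p q by (simp add: c_def \<gamma>_def field_simps)
      then have "cmod (f n w) powr p = defect (Z n) powr (c - 2) * cmod (1 - cnj (Z n) * w) powr (-c)"
        using nf[OF w] by (simp add: powr_mult powr_powr c_def)
      moreover have "\<sigma> (cmod w) \<le> M" using w by (intro bounds) auto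
      ultimately have "cmod (f n w) powr p * \<sigma> (cmod w) \<le> defect (Z n) powr (c - 2) * cmod (1 - cnj (Z n) * w) powr (-c) * M"
        by (simp add: mult_left_mono)
      then show "ennreal (cmod (f n w) powr p * \<sigma> (cmod w)) \<le> ennreal A * ennreal (cmod (1 - cnj (Z n) * w) powr (-c))"
        using A by (simp add: A_def ennreal_leI mult_ac flip: ennreal_mult)
    qed
    also have "\<dots> = ennreal A * (\<integral>\<^sup>+ w. ennreal (cmod (1 - cnj (Z n) * w) powr (-c)) \<partial>area_measure)"
    proof (rule nn_integral_cmult)
      have "continuous_on unit_disk (\<lambda>w. cmod (1 - cnj (Z n) * w) powr (-c))"
        using norm_one_minus_cnj_mult_pos[OF Z(1), of _ n] by (intro continuous_on_powr continuous_intros) fastforce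
      then show "(\<lambda>w. ennreal (cmod (1 - cnj (Z n) * w) powr (-c))) \<in> borel_measurable area_measure"
        by (intro measurable_compose[OF _ measurable_ennreal] borel_measurable_continuous_on_disk[of area_measure]) simp_all
    qed
    also have "\<dots> \<le> ennreal A * ennreal (C * (1 - cmod (Z n)) powr (2 - c))"
      using Z(1) Zh by (intro mult_left_mono C(2)) auto
    also have "\<dots> = ennreal (A * (C * (1 - cmod (Z n)) powr (2 - c)))"
      using A C by (simp add: ennreal_mult)
    also have "\<dots> \<le> ennreal K"
    proof (rule ennreal_leI)
      have "(1 - cmod (Z n)) powr (2 - c) \<le> (defect (Z n) / 2) powr (2 - c)"
        using dZ[of n] defect_bounds(2)[OF Z(1), of n] c by (intro powr_mono2') auto
      then have "A * (C * (1 - cmod (Z n)) powr (2 - c)) \<le> A * (C * (defect (Z n) / 2) powr (2 - c))"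
        using A C by (intro mult_left_mono) auto
      also have "\<dots> = K * (defect (Z n) powr (c - 2) * defect (Z n) powr (2 - c))"
      proof -
        have "2 powr (c - 2) = 1 / 2 powr (2 - c)"
          using powr_minus_divide[of 2 "2 - c"] by simp
        then have "(defect (Z n) / 2) powr (2 - c) = 2 powr (c - 2) * defect (Z n) powr (2 - c)"
          using dZ[of n] by (simp add: powr_divide)
        then show ?thesis by (simp only: A_def K_def mult_ac)
      qed
      also have "defect (Z n) powr (c - 2) * defect (Z n) powr (2 - c) = 1"
        using dZ[of n] by (simp flip: powr_add)
      finally show "A * (C * (1 - cmod (Z n)) powr (2 - c)) \<le> K" by simp
    qed
    finally show ?thesis .
  qed
  have K0: "0 \<le> K" using M C by (simp add: K_def)
  have "\<forall>n. f n \<in> bergman_space p \<sigma>"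
    using hol le_less_trans[OF K ennreal_less_top] by (simp add: bergman_space_def)
  moreover have "\<forall>n. bergman_norm p \<sigma> (f n) \<le> K powr (1 / p)"
  proof
    fix n
    have "enn2real (bergman_integral p \<sigma> (f n)) \<le> K" using K K0 by (simp add: enn2real_leI)
    then show "bergman_norm p \<sigma> (f n) \<le> K powr (1 / p)"
      unfolding bergman_norm_def using p by (intro powr_mono2) auto
  qed
  moreover have "uniform_limit L f (\<lambda>_. 0) sequentially" if L: "compact L" "L \<subseteq> unit_disk" for L
  proof (cases "L = {}")
    case False
    obtain x where x: "x \<in> L" "\<And>y. y \<in> L \<Longrightarrow> defect x \<le> defect y"
      using continuous_attains_inf[OF L(1) False continuous_on_defect] by blast
    define B where "B = (defect x / 2) powr (- (s / q))"
    have dx: "0 < defect x" using x L by (auto intro: defect_pos)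
    have "(\<lambda>n. defect (Z n) powr ((s - \<gamma>) / q) * B) \<longlonglongrightarrow> 0 * B"
    proof (intro tendsto_mult_right)
      have "0 < (s - \<gamma>) / q" using s q by (simp add: \<gamma>_def)
      then show "(\<lambda>n. defect (Z n) powr ((s - \<gamma>) / q)) \<longlonglongrightarrow> 0"
        using tendsto_powr'[OF Z0 tendsto_const, of "(s - \<gamma>) / q"] dZ by (simp add: less_imp_le)
    qed
    then have lim: "(\<lambda>n. defect (Z n) powr ((s - \<gamma>) / q) * B) \<longlonglongrightarrow> 0" by simp
    show ?thesis
    proof (rule uniform_limitI)
      fix e :: real assume "0 < e"
      with lim have "eventually (\<lambda>n. defect (Z n) powr ((s - \<gamma>) / q) * B < e) sequentially"
        by (rule order_tendstoD(2))
      then show "eventually (\<lambda>n. \<forall>w\<in>L. dist (f n w) 0 < e) sequentially"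
      proof eventually_elim
        case (elim n)
        show ?case
        proof
          fix w assume w: "w \<in> L"
          then have wD: "w \<in> unit_disk" using L by blast
          have "cmod (1 - cnj (Z n) * w) powr (- (s / q)) \<le> B"
            unfolding B_def using dx x(2)[OF w] s0 q defect_le_norm_one_minus_cnj_mult(2)[OF Z(1) wD, of n]
            by (intro powr_mono2') auto
          then have "cmod (f n w) \<le> defect (Z n) powr ((s - \<gamma>) / q) * B"
            using nf[OF wD] by (simp add: mult_left_mono)
          then show "dist (f n w) 0 < e" using elim by simp
        qed
      qed
    qed
  qed simp
  ultimately have lim: "(\<lambda>n. \<integral>\<^sup>+ w. ennreal (cmod (f n w) powr q) \<partial>\<Omega>) \<longlonglongrightarrow> 0"
    using van unfolding vanishing_bergman_carleson_def by blast
  have "(\<integral>\<^sup>+ w. ennreal (cmod (f n w) powr q) \<partial>\<Omega>) = ennreal (\<Phi> (Z n))" for n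
  proof -
    have "(\<integral>\<^sup>+ w. ennreal (cmod (f n w) powr q) \<partial>\<Omega>)
       = (\<integral>\<^sup>+ w. ennreal (defect (Z n) powr (s - \<gamma>) * cmod (1 - cnj (Z n) * w) powr (-s)) \<partial>\<Omega>)"
      using q by (intro nn_integral_cong) (simp add: nf finite_borel_measure_on_diskD(2)[OF \<Omega>] powr_mult powr_powr)
    also have "\<dots> = ennreal (\<integral>w. defect (Z n) powr (s - \<gamma>) * cmod (1 - cnj (Z n) * w) powr (-s) \<partial>\<Omega>)"
      using integrable_kernel_power[OF \<Omega> Z(1) less_imp_le[OF s0], of n]
      by (intro nn_integral_eq_integral integrable_mult_right) auto
    finally show ?thesis by (simp add: \<Phi>_def kernel_potential_def)
  qed
  then have "(\<lambda>n. ennreal (\<Phi> (Z n))) \<longlonglongrightarrow> 0" using lim by simp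
  then have "eventually (\<lambda>n. ennreal (\<Phi> (Z n)) < ennreal \<epsilon>) sequentially"
    by (rule order_tendstoD(2)) (use \<epsilon> in simp)
  then obtain n where "ennreal (\<Phi> (Z n)) < ennreal \<epsilon>" by (auto simp: eventually_sequentially)
  then show False using Z(3)[of n] \<Phi>0 by (simp add: ennreal_less_iff)
qed

section \<open>Equivalence of the conditions\<close>

text \<open>
A disk of radius \<open>(1 - r) / 16\<close> about \<open>x\<close> is covered by the lattice disks that it meets. Their number
is bounded by the overlap constant, and their centres have defect at most a constant times
that of \<open>x\<close>, so near the boundary only late lattice points occur.
\<close>

lemma lattice_mass_imp_vanishing_disk_mass:
  fixes r \<gamma> :: real
  assumes \<Omega>: "finite_borel_measure_on_disk \<Omega>" and r: "0 < r" "r < 1" and \<gamma>: "0 \<le> \<gamma>"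
    and lat: "lattice_in_disk r z"
    and lim: "(\<lambda>k. measure \<Omega> (pseudohyperbolic_disk (z k) r) / defect (z k) powr \<gamma>) \<longlonglongrightarrow> 0"
  shows "vanishing_disk_mass \<gamma> ((1 - r) / 16) \<Omega>"
  unfolding vanishing_disk_mass_iff
proof (intro allI impI)
  fix \<epsilon> :: real assume \<epsilon>: "0 < \<epsilon>"
  interpret O: finite_measure \<Omega> using finite_borel_measure_on_diskD(3)[OF \<Omega>] .
  define R where "R = (1 - r) / 16"
  have R: "0 < R" "R < 1" using r by (auto simp: R_def)
  have zD: "z k \<in> unit_disk" for k using lat unfolding lattice_in_disk_def by blast
  have dz: "0 < defect (z k)" for k using defect_pos[OF zD] .
  obtain M :: nat where M: "0 < M" "\<And>w. w \<in> unit_disk \<Longrightarrow>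
      finite {k. w \<in> pseudohyperbolic_disk (z k) ((1 + r) / 2)} \<and>
      card {k. w \<in> pseudohyperbolic_disk (z k) ((1 + r) / 2)} \<le> M"
    using lat unfolding lattice_in_disk_def by blast
  (* The defect changes by at most the first factor inside a lattice disk and by
     at most the second one inside the small disk about x. *)
  define c where "c = 2 / (1 - r) * (2 / (1 - R))"
  have c: "0 < c" using r R by (simp add: c_def)
  define e where "e = \<epsilon> / (2 * real M * c powr \<gamma>)"
  have e: "0 < e" using \<epsilon> M c by (simp add: e_def)
  have "eventually (\<lambda>k. measure \<Omega> (pseudohyperbolic_disk (z k) r) / defect (z k) powr \<gamma> < e) sequentially"
    using lim e by (rule order_tendstoD(2))
  then obtain N where "\<And>k. N \<le> k \<Longrightarrow> measure \<Omega> (pseudohyperbolic_disk (z k) r) / defect (z k) powr \<gamma> < e"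
    by (auto simp: eventually_sequentially)
  then have N: "measure \<Omega> (pseudohyperbolic_disk (z k) r) \<le> e * defect (z k) powr \<gamma>" if "N \<le> k" for k
    using that dz[of k] by (simp add: divide_less_eq less_imp_le)
  (* Below this threshold none of the first N lattice points is near; the entry 1
     covers the case N = 0. *)
  define \<delta> where "\<delta> = Min (insert 1 ((\<lambda>k. defect (z k)) ` {..<N})) / c"
  have \<delta>0: "0 < \<delta>" using dz c by (simp add: \<delta>_def)
  have \<delta>N: "c * \<delta> \<le> defect (z k)" if "k < N" for k
    using that c by (simp add: \<delta>_def)
  show "\<exists>\<delta>>0. \<forall>x\<in>unit_disk. defect x < \<delta> \<longrightarrow>
    measure \<Omega> (pseudohyperbolic_disk x ((1 - r) / 16)) < \<epsilon> * defect x powr \<gamma>"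
    unfolding R_def[symmetric]
  proof (intro exI[of _ \<delta>] conjI \<delta>0 ballI impI)
    fix x assume x: "x \<in> unit_disk" and small: "defect x < \<delta>"
    have dx: "0 < defect x" using defect_pos[OF x] .
    define S where "S = {k. pseudohyperbolic_disk (z k) r \<inter> pseudohyperbolic_disk x R \<noteq> {}}"
    have near: "defect (z k) \<le> c * defect x" if k: "k \<in> S" for k
    proof -
      obtain w where w: "w \<in> pseudohyperbolic_disk (z k) r" "w \<in> pseudohyperbolic_disk x R"
        using k by (auto simp: S_def)
      have wD: "w \<in> unit_disk" using w pseudohyperbolic_disk_subset by blast
      have "defect (z k) \<le> 2 / (1 - r) * defect w"
        using mem_pseudohyperbolic_disk_commute[OF zD w(1)] by (rule defect_le_in_pseudohyperbolic_disk[OF wD r])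
      also have "\<dots> \<le> 2 / (1 - r) * (2 / (1 - R) * defect x)"
        using defect_le_in_pseudohyperbolic_disk[OF x R w(2)] r by (intro mult_left_mono) auto
      finally show ?thesis by (simp add: c_def)
    qed
    have "S \<subseteq> {k. x \<in> pseudohyperbolic_disk (z k) ((1 + r) / 2)}"
      using pseudohyperbolic_quasi_triangle[OF zD x r] by (auto simp: S_def R_def)
    then have S: "finite S" "card S \<le> M"
      using M(2)[OF x] by (auto intro: finite_subset card_mono[THEN order_trans])
    have mass: "measure \<Omega> (pseudohyperbolic_disk (z k) r) \<le> e * (c * defect x) powr \<gamma>" if k: "k \<in> S" for k
    proof -
      have "N \<le> k"
      proof (rule ccontr)
        assume "\<not> N \<le> k"
        then have "c * \<delta> \<le> defect (z k)" by (intro \<delta>N) simp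
        also have "\<dots> \<le> c * defect x" by (rule near[OF k])
        finally show False using small c by simp
      qed
      then have "measure \<Omega> (pseudohyperbolic_disk (z k) r) \<le> e * defect (z k) powr \<gamma>" by (rule N)
      also have "\<dots> \<le> e * (c * defect x) powr \<gamma>"
        using near[OF k] dz[of k] e \<gamma> by (intro mult_left_mono powr_mono2) auto
      finally show ?thesis .
    qed
    have sets: "pseudohyperbolic_disk a s \<in> sets \<Omega>" if "a \<in> unit_disk" for a s
      by (rule pseudohyperbolic_disk_in_sets[OF \<Omega> that])
    have "pseudohyperbolic_disk x R \<subseteq> (\<Union>k\<in>S. pseudohyperbolic_disk (z k) r)"
    proof
      fix w assume w: "w \<in> pseudohyperbolic_disk x R"
      then have "w \<in> unit_disk" using pseudohyperbolic_disk_subset by blast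
      then obtain k where k: "w \<in> pseudohyperbolic_disk (z k) r" using lat unfolding lattice_in_disk_def by blast
      then have "k \<in> S" using w by (auto simp: S_def)
      then show "w \<in> (\<Union>k\<in>S. pseudohyperbolic_disk (z k) r)" using k by blast
    qed
    then have "measure \<Omega> (pseudohyperbolic_disk x R) \<le> measure \<Omega> (\<Union>k\<in>S. pseudohyperbolic_disk (z k) r)"
      by (rule O.finite_measure_mono) (use S sets zD in \<open>auto intro: sets.finite_UN\<close>)
    also have "\<dots> \<le> (\<Sum>k\<in>S. measure \<Omega> (pseudohyperbolic_disk (z k) r))"
      by (rule O.finite_measure_subadditive_finite) (use S sets zD in auto)
    also have "\<dots> \<le> real (card S) * (e * (c * defect x) powr \<gamma>)"
      using mass by (rule sum_bounded_above)
    also have "\<dots> \<le> real M * (e * (c * defect x) powr \<gamma>)"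
      using S e by (intro mult_right_mono) auto
    also have "\<dots> = \<epsilon> / 2 * defect x powr \<gamma>"
      using M c dx by (simp add: e_def powr_mult)
    also have "\<dots> < \<epsilon> * defect x powr \<gamma>" using \<epsilon> dx by simp
    finally show "measure \<Omega> (pseudohyperbolic_disk x R) < \<epsilon> * defect x powr \<gamma>" .
  qed
qed

text \<open>
The constants do not depend on the measure or the point: they come from the bounds of the weight and the area of
the disk. Absolute values put the bounds in the form used for comparing limits.
\<close>

lemma averaging_quotient_comparable:
  fixes p q R :: real
  assumes \<sigma>: "weight \<sigma>" and p: "0 < p" and q: "0 < q" and R: "0 < R" "R < 1"
  obtains A B where "\<And>z \<Omega>. z \<in> unit_disk \<Longrightarrow>
      \<bar>averaging_function R \<Omega> z / (\<sigma> (cmod z) powr (q / p) * (1 - (cmod z)\<^sup>2) powr (2 * (q - p) / p))\<bar>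
        \<le> \<bar>measure \<Omega> (pseudohyperbolic_disk z R) / defect z powr (2 * q / p)\<bar> * A"
    "\<And>z \<Omega>. z \<in> unit_disk \<Longrightarrow>
      \<bar>measure \<Omega> (pseudohyperbolic_disk z R) / defect z powr (2 * q / p)\<bar>
        \<le> \<bar>averaging_function R \<Omega> z / (\<sigma> (cmod z) powr (q / p) * (1 - (cmod z)\<^sup>2) powr (2 * (q - p) / p))\<bar> * B"
proof -
  obtain m M where m: "0 < m" "\<And>x. x \<in> {0..1} \<Longrightarrow> m \<le> \<sigma> x" and M: "\<And>x. x \<in> {0..1} \<Longrightarrow> \<sigma> x \<le> M"
    using weight_bounds[OF \<sigma>] by metis
  define lo where "lo = (R / 2)\<^sup>2 * m powr (q / p)"
  define hi where "hi = (R / (1 - R))\<^sup>2 * M powr (q / p)"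
  have lo: "0 < lo" using R m by (simp add: lo_def)
  have key: "averaging_function R \<Omega> z / (\<sigma> (cmod z) powr (q / p) * (1 - (cmod z)\<^sup>2) powr (2 * (q - p) / p))
      \<le> measure \<Omega> (pseudohyperbolic_disk z R) / defect z powr (2 * q / p) * (1 / lo) \<and>
      measure \<Omega> (pseudohyperbolic_disk z R) / defect z powr (2 * q / p)
      \<le> averaging_function R \<Omega> z / (\<sigma> (cmod z) powr (q / p) * (1 - (cmod z)\<^sup>2) powr (2 * (q - p) / p)) * hi"
    if z: "z \<in> unit_disk" for z \<Omega>
  proof -
    define D where "D = defect z powr (2 * q / p)"
    define X where "X = measure area_measure (pseudohyperbolic_disk z R) *
      (\<sigma> (cmod z) powr (q / p) * (1 - (cmod z)\<^sup>2) powr (2 * (q - p) / p))"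
    have d: "0 < defect z" using defect_pos[OF z] .
    then have D: "0 < D" by (simp add: D_def)
    have e: "(defect z)\<^sup>2 * (1 - (cmod z)\<^sup>2) powr (2 * (q - p) / p) = D"
    proof -
      have "2 + 2 * (q - p) / p = 2 * q / p" using p by (simp add: field_simps)
      moreover have "(defect z)\<^sup>2 = defect z powr 2" using d by simp
      ultimately show ?thesis
        unfolding D_def defect_def[symmetric] by (simp only: powr_add[symmetric])
    qed
    have s: "m \<le> \<sigma> (cmod z)" "\<sigma> (cmod z) \<le> M" using z by (auto intro!: m(2) M)
    have sw: "m powr (q / p) \<le> \<sigma> (cmod z) powr (q / p)" "\<sigma> (cmod z) powr (q / p) \<le> M powr (q / p)"
      using s m(1) p q by (auto intro!: powr_mono2)
    note area = measure_pseudohyperbolic_disk_bounds[OF z R]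
    have "lo * D = (R / 2)\<^sup>2 * (defect z)\<^sup>2 * (m powr (q / p) * (1 - (cmod z)\<^sup>2) powr (2 * (q - p) / p))"
      unfolding e[symmetric] lo_def by (simp only: mult_ac)
    also have "\<dots> \<le> X"
      unfolding X_def using area(1) sw(1) by (intro mult_mono) auto
    finally have 1: "lo * D \<le> X" .
    have "X \<le> (R / (1 - R))\<^sup>2 * (defect z)\<^sup>2 * (M powr (q / p) * (1 - (cmod z)\<^sup>2) powr (2 * (q - p) / p))"
      unfolding X_def using area(2) sw(2) by (intro mult_mono) auto
    also have "\<dots> = hi * D"
      unfolding e[symmetric] hi_def by (simp only: mult_ac)
    finally have 2: "X \<le> hi * D" .
    have X: "0 < X" using 1 lo D by (meson less_le_trans mult_pos_pos)
    define N where "N = measure \<Omega> (pseudohyperbolic_disk z R)"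
    have N: "0 \<le> N" by (simp add: N_def)
    have avg: "averaging_function R \<Omega> z / (\<sigma> (cmod z) powr (q / p) * (1 - (cmod z)\<^sup>2) powr (2 * (q - p) / p)) = N / X"
      by (simp add: averaging_function_def X_def N_def)
    have "N / X \<le> N / (lo * D)" using 1 N lo D X by (intro divide_left_mono) auto
    moreover have "N / D \<le> N / X * hi"
      using mult_left_mono[OF 2 N] D X by (simp add: divide_simps mult_ac)
    ultimately show ?thesis unfolding avg D_def[symmetric] N_def[symmetric] by (simp add: mult.commute)
  qed
  have nn: "0 \<le> averaging_function R \<Omega> z / (\<sigma> (cmod z) powr (q / p) * (1 - (cmod z)\<^sup>2) powr (2 * (q - p) / p))" for z \<Omega>
    by (simp add: averaging_function_def)
  have nn': "0 \<le> measure \<Omega> (pseudohyperbolic_disk z R) / defect z powr (2 * q / p)" for z \<Omega>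
    by simp
  show ?thesis
    by (rule that[of "1 / lo" hi]) (simp_all only: abs_of_nonneg[OF nn] abs_of_nonneg[OF nn'] key)
qed

lemma eventually_in_disk: "eventually (\<lambda>z. z \<in> unit_disk) to_boundary"
  unfolding eventually_to_boundary by (intro exI[of _ 1]) auto


theorem theorem2:
  fixes \<sigma> :: "real \<Rightarrow> real" and \<alpha> p q t :: real and \<Omega> :: "complex measure"
  assumes "admissible_weight \<sigma>"
    and "\<alpha> > -1"
    and "finite_borel_measure_on_disk \<Omega>"
    and "0 < p" and "p \<le> q"
    and "t > 2 * q / (p * (\<alpha> + 2))"
  defines "a \<equiv> vanishing_bergman_carleson p q \<sigma> \<Omega>"
    and "b \<equiv> ((\<lambda>z. berezin_transform \<alpha> t \<Omega> z /
                 (\<sigma> (cmod z) powr (q / p) *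
                  (1 - (cmod z)\<^sup>2) powr (2 * q / p - (\<alpha> + 2) * t / 2))) \<longlongrightarrow> 0) to_boundary"
    and "c \<equiv> \<lambda>R. ((\<lambda>z. averaging_function R \<Omega> z /
                 (\<sigma> (cmod z) powr (q / p) *
                  (1 - (cmod z)\<^sup>2) powr (2 * (q - p) / p))) \<longlongrightarrow> 0) to_boundary"
    and "d \<equiv> \<lambda>r z. (\<lambda>k::nat. averaging_function r \<Omega> (z k) /
                 (\<sigma> (cmod (z k)) powr (q / p) *
                  (1 - (cmod (z k))\<^sup>2) powr (2 * (q - p) / p))) \<longlonglongrightarrow> 0"
  shows "(a \<longleftrightarrow> b) \<and>
    (a \<longleftrightarrow> (\<exists>R\<in>{0<..<1}. c R)) \<and>
    (a \<longleftrightarrow> (\<forall>R\<in>{0<..<1}. c R)) \<and>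
    (a \<longleftrightarrow> (\<exists>r\<in>{0<..<1}. \<exists>z. lattice_in_disk r z \<and> d r z)) \<and>
    (a \<longleftrightarrow> (\<forall>r\<in>{0<..<1}. \<forall>z. lattice_in_disk r z \<longrightarrow> d r z))"
proof -
  have \<sigma>: "weight \<sigma>" using assms(1) by (simp add: admissible_weight_def)
  note \<Omega> = assms(3) and p = assms(4)
  have q: "0 < q" using assms(4,5) by simp
  define \<gamma> where "\<gamma> = 2 * q / p"
  have \<gamma>: "0 \<le> \<gamma>" using p q by (simp add: \<gamma>_def)
  define s where "s = (\<alpha> + 2) * t"
  have s: "\<gamma> < s"
    using assms(2,6) p by (simp add: \<gamma>_def s_def divide_less_eq mult_ac)
  obtain m M where m: "0 < m" "\<And>x. x \<in> {0..1} \<Longrightarrow> m \<le> \<sigma> x" and M: "\<And>x. x \<in> {0..1} \<Longrightarrow> \<sigma> x \<le> M"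
    using weight_bounds[OF \<sigma>] by metis
  define \<Phi> where "\<Phi> = (\<lambda>z. defect z powr (s - \<gamma>) * kernel_potential s \<Omega> z)"
  have \<Phi>0: "0 \<le> \<Phi> z" for z by (simp add: \<Phi>_def kernel_potential_def)
  have berezin: "berezin_transform \<alpha> t \<Omega> z / (\<sigma> (cmod z) powr (q / p) *
      (1 - (cmod z)\<^sup>2) powr (2 * q / p - (\<alpha> + 2) * t / 2)) = \<Phi> z / \<sigma> (cmod z) powr (q / p)"
    if z: "z \<in> unit_disk" for z
  proof -
    have "defect z powr (s / 2) / defect z powr (\<gamma> - s / 2) = defect z powr (s - \<gamma>)"
      unfolding powr_diff[symmetric] by (simp add: algebra_simps)
    then show ?thesis
      unfolding berezin_transform_eq_kernel_potential[OF \<Omega> z] \<Phi>_def defect_def[symmetric] s_def[symmetric] \<gamma>_def[symmetric]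
      by (metis (no_types, opaque_lifting) divide_divide_eq_left mult.commute times_divide_eq_left)
  qed
  have b_iff: "b \<longleftrightarrow> (\<Phi> \<longlongrightarrow> 0) to_boundary"
  proof
    have ev: "eventually (\<lambda>z. norm (\<Phi> z) \<le> norm (berezin_transform \<alpha> t \<Omega> z / (\<sigma> (cmod z) powr (q / p) *
      (1 - (cmod z)\<^sup>2) powr (2 * q / p - (\<alpha> + 2) * t / 2))) * M powr (q / p)) to_boundary"
      using eventually_in_disk
    proof eventually_elim
      case (elim z)
      then have "0 < \<sigma> (cmod z)" "\<sigma> (cmod z) \<le> M" using m(1) m(2)[of "cmod z"] M[of "cmod z"] by auto
      then have "\<sigma> (cmod z) powr (q / p) \<le> M powr (q / p)" "0 < \<sigma> (cmod z) powr (q / p)"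
        using p q by (auto intro: powr_mono2)
      then have "\<Phi> z \<le> \<Phi> z / \<sigma> (cmod z) powr (q / p) * M powr (q / p)"
        using mult_left_mono[OF _ \<Phi>0, of "\<sigma> (cmod z) powr (q / p)" "M powr (q / p)" z] by (simp add: field_simps)
      then show ?case unfolding berezin[OF elim] using \<Phi>0[of z] by simp
    qed
    show "(\<Phi> \<longlongrightarrow> 0) to_boundary" if b
      using tendsto_0_le[OF that[unfolded b_def] ev] .
    have ev': "eventually (\<lambda>z. norm (berezin_transform \<alpha> t \<Omega> z / (\<sigma> (cmod z) powr (q / p) *
      (1 - (cmod z)\<^sup>2) powr (2 * q / p - (\<alpha> + 2) * t / 2))) \<le> norm (\<Phi> z) * (1 / m powr (q / p))) to_boundary"
      using eventually_in_disk
    proof eventually_elim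
      case (elim z)
      then have "m \<le> \<sigma> (cmod z)" using m(2)[of "cmod z"] by auto
      then have "m powr (q / p) \<le> \<sigma> (cmod z) powr (q / p)" "0 < m powr (q / p)"
        using p q m(1) by (auto intro: powr_mono2)
      then have "\<Phi> z / \<sigma> (cmod z) powr (q / p) \<le> \<Phi> z / m powr (q / p)"
        using \<Phi>0[of z] by (intro divide_left_mono mult_pos_pos) linarith+
      then show ?case unfolding berezin[OF elim] using \<Phi>0[of z] by simp
    qed
    show b if "(\<Phi> \<longlongrightarrow> 0) to_boundary"
      unfolding b_def using tendsto_0_le[OF that ev'] .
  qed
  have c_iff: "c R \<longleftrightarrow> vanishing_disk_mass \<gamma> R \<Omega>" if R: "R \<in> {0<..<1}" for R
  proof -
    from R have "0 < R" "R < 1" by auto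
    from averaging_quotient_comparable[OF \<sigma> p q this] obtain A B where
      A: "\<And>z \<Omega>. z \<in> unit_disk \<Longrightarrow>
      \<bar>averaging_function R \<Omega> z / (\<sigma> (cmod z) powr (q / p) * (1 - (cmod z)\<^sup>2) powr (2 * (q - p) / p))\<bar>
        \<le> \<bar>measure \<Omega> (pseudohyperbolic_disk z R) / defect z powr (2 * q / p)\<bar> * A" and
      B: "\<And>z \<Omega>. z \<in> unit_disk \<Longrightarrow>
      \<bar>measure \<Omega> (pseudohyperbolic_disk z R) / defect z powr (2 * q / p)\<bar>
        \<le> \<bar>averaging_function R \<Omega> z / (\<sigma> (cmod z) powr (q / p) * (1 - (cmod z)\<^sup>2) powr (2 * (q - p) / p))\<bar> * B"
      by blast
    show ?thesis
      unfolding c_def vanishing_disk_mass_def \<gamma>_def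
    proof
      assume l: "((\<lambda>z. averaging_function R \<Omega> z / (\<sigma> (cmod z) powr (q / p) *
          (1 - (cmod z)\<^sup>2) powr (2 * (q - p) / p))) \<longlongrightarrow> 0) to_boundary"
      show "((\<lambda>z. measure \<Omega> (pseudohyperbolic_disk z R) / defect z powr (2 * q / p)) \<longlongrightarrow> 0) to_boundary"
        by (rule tendsto_0_le[OF l eventually_mono[OF eventually_in_disk]]) (simp only: real_norm_def, rule B)
    next
      assume l: "((\<lambda>z. measure \<Omega> (pseudohyperbolic_disk z R) / defect z powr (2 * q / p)) \<longlongrightarrow> 0) to_boundary"
      show "((\<lambda>z. averaging_function R \<Omega> z / (\<sigma> (cmod z) powr (q / p) *
          (1 - (cmod z)\<^sup>2) powr (2 * (q - p) / p))) \<longlongrightarrow> 0) to_boundary"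
        by (rule tendsto_0_le[OF l eventually_mono[OF eventually_in_disk]]) (simp only: real_norm_def, rule A)
    qed
  qed
  have ab: "b" if a
    using vanishing_bergman_carleson_imp_kernel_potential[OF \<sigma> \<Omega> p q s[unfolded \<gamma>_def] that[unfolded a_def]]
    unfolding b_iff \<Phi>_def \<gamma>_def .
  have bc: "c R" if b and R: "R \<in> {0<..<1}" for R
    unfolding c_iff[OF R] vanishing_disk_mass_def
  proof (rule tendsto_0_le)
    show "(\<Phi> \<longlongrightarrow> 0) to_boundary" using that b_iff by simp
    show "eventually (\<lambda>z. norm (measure \<Omega> (pseudohyperbolic_disk z R) / defect z powr \<gamma>)
        \<le> norm (\<Phi> z) * (1 - R) powr (-s)) to_boundary"
      using eventually_in_disk
    proof eventually_elim
      case (elim z)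
      have "measure \<Omega> (pseudohyperbolic_disk z R) / defect z powr \<gamma>
          \<le> (1 - R) powr (-s) * (defect z powr s * kernel_potential s \<Omega> z) / defect z powr \<gamma>"
        using disk_mass_le_kernel_potential[OF \<Omega> elim, of R s] R s \<gamma> by (intro divide_right_mono) auto
      also have "\<dots> = \<Phi> z * (1 - R) powr (-s)" by (simp add: \<Phi>_def powr_diff)
      finally show ?case using \<Phi>0[of z] by simp
    qed
  qed
  have ca: "a" if "R \<in> {0<..<1}" "c R" for R
    unfolding a_def
    using vanishing_disk_mass_imp_vanishing_bergman_carleson[OF \<sigma> \<Omega> p assms(5), of R] that c_iff
    by (simp add: \<gamma>_def)
  have cd: "d r z" if "c r" "lattice_in_disk r z" "r \<in> {0<..<1}" for r z
    unfolding d_def using filterlim_compose[OF that(1)[unfolded c_def] lattice_tends_to_boundary[OF that(2)]] that(3) by simp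
  have dc: "c ((1 - r) / 16)" if dr: "d r z" and lat: "lattice_in_disk r z" and r: "r \<in> {0<..<1}" for r z
  proof -
    from r have r': "0 < r" "r < 1" by auto
    have zD: "z k \<in> unit_disk" for k using lat unfolding lattice_in_disk_def by blast
    from averaging_quotient_comparable[OF \<sigma> p q r'] obtain A B where
      "\<And>z \<Omega>. z \<in> unit_disk \<Longrightarrow>
      \<bar>averaging_function r \<Omega> z / (\<sigma> (cmod z) powr (q / p) * (1 - (cmod z)\<^sup>2) powr (2 * (q - p) / p))\<bar>
        \<le> \<bar>measure \<Omega> (pseudohyperbolic_disk z r) / defect z powr (2 * q / p)\<bar> * A" and
      B: "\<And>z \<Omega>. z \<in> unit_disk \<Longrightarrow>
      \<bar>measure \<Omega> (pseudohyperbolic_disk z r) / defect z powr (2 * q / p)\<bar>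
        \<le> \<bar>averaging_function r \<Omega> z / (\<sigma> (cmod z) powr (q / p) * (1 - (cmod z)\<^sup>2) powr (2 * (q - p) / p))\<bar> * B"
      by blast
    have "(\<lambda>k. measure \<Omega> (pseudohyperbolic_disk (z k) r) / defect (z k) powr \<gamma>) \<longlonglongrightarrow> 0"
      by (rule tendsto_0_le[OF dr[unfolded d_def] always_eventually]) (simp only: real_norm_def \<gamma>_def, rule allI, rule B[OF zD])
    then have "vanishing_disk_mass \<gamma> ((1 - r) / 16) \<Omega>"
      by (rule lattice_mass_imp_vanishing_disk_mass[OF \<Omega> r' \<gamma> lat])
    then show ?thesis using c_iff[of "(1 - r) / 16"] r' by simp
  qed
  have da: "a" if "d r z" "lattice_in_disk r z" "r \<in> {0<..<1}" for r z
    using ca[OF _ dc[OF that]] that(3) by simp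
  obtain z0 where z0: "lattice_in_disk (1 / 2) z0" using lattice_in_disk_exists[of "1 / 2"] by auto
  have half: "(1 / 2 :: real) \<in> {0<..<1}" by simp
  have "a \<longleftrightarrow> b" using ab bc ca half by blast
  moreover have "a \<longleftrightarrow> (\<exists>R\<in>{0<..<1}. c R)" using ab bc ca half by blast
  moreover have "a \<longleftrightarrow> (\<forall>R\<in>{0<..<1}. c R)" using ab bc ca half by blast
  moreover have "a \<longleftrightarrow> (\<exists>r\<in>{0<..<1}. \<exists>z. lattice_in_disk r z \<and> d r z)"
    using ab bc cd da z0 half by blast
  moreover have "a \<longleftrightarrow> (\<forall>r\<in>{0<..<1}. \<forall>z. lattice_in_disk r z \<longrightarrow> d r z)"
    using ab bc cd da z0 half by blast
  ultimately show ?thesis by blast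
qed

end
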